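(* Let $T>0$, $\theta>0$, $\sigma\ge0$ and $\sigma_0\ge 0$. Let $X$ be the Ornstein-Uhlenbeck process on $[0,T]$ solving $dX_t=\theta(\mu-X_t)\,dt+\sigma\,dW_t$, where $\mu\in\mathbb{R}$, $W$ is a standard Brownian motion and $X_0\sim\mathcal N(m_0,\sigma_0^2)$ is independent of $W$. Let $(\omega_n)_{n\ge1}$ be the increasingly sorted sequence of the positive solutions $\omega$ of $$\omega\sigma^2\cos(\omega T)+\big(-\omega^2\sigma_0^2+\theta\sigma^2-\theta^2\sigma_0^2\big)\sin(\omega T)=0 .$$ Then the Karhunen-Loève eigensystem $(e_n^{OU},\lambda_n^{OU})_{n\ge1}$ of $X$ is given, for $n\ge1$, by $$\lambda_n^{OU}=\frac{\sigma^2}{\omega_n^2+\theta^2},\qquad e_n^{OU}(t)=K_n\big(\omega_n\sigma_0^2\cos(\omega_n t)+(\sigma^2-\theta\sigma_0^2)\sin(\omega_n t)\big),\quad t\in[0,T],$$ where $K_n$ is the normalization constant (so that $\|e_n^{OU}\|_{L^2([0,T])}=1$). If $(\sigma,\sigma_0)\neq(0,0)$, $K_n$ is given by $$\frac1{K_n^2}=\frac12\sigma_0^2(\sigma^2-\theta\sigma_0^2)\big(1-\cos(2\omega_nT)\big)+\frac12\sigma_0^4\omega_n^2\Big(T+\frac{\sin(2\omega_nT)}{2\omega_n}\Big)+\frac12(\sigma^2-\theta\sigma_0^2)^2\Big(T-\frac{\sin(2\omega_nT)}{2\omega_n}\Big).$$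
   Context: The Karhunen-Loève eigensystem of a Gaussian process $X$ on $[0,T]$ with continuous covariance function is the system of orthonormal eigenvectors $e_n$ in $L^2([0,T],dt)$ and ordered non-zero eigenvalues $\lambda_1\ge\lambda_2\ge\cdots>0$ (repeated with multiplicity) of the covariance operator $f\mapsto\int_0^T\mathrm{cov}(X_s,X_\cdot)f(s)\,ds$. For the process above, $\mathrm{cov}(X_s,X_t)=\frac{\sigma^2}{2\theta}e^{-\theta(s+t)}\big(e^{2\theta\min(s,t)}-1\big)+\sigma_0^2e^{-\theta(s+t)}$.
   Formalization: That the pairs are the complete Karhunen-Loève eigensystem is claimed only if θ²Tσ₀² < σ²(1+θT); otherwise a non-zero eigenvalue is missed (e.g. θ=T=σ=1, σ₀²=2: 2−t, eigenvalue 1). Orthonormal eigenpairs and the K_n formula hold without this condition. *)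

theory Defs
  imports "HOL-Probability.Probability"
begin

text \<open>The law \<open>N(m, s\<^sup>2)\<close>. The case \<open>s = 0\<close>, a point mass, is separate because
  \<^const>\<open>normal_density\<close> is identically \<open>0\<close> there.\<close>

definition has_normal_law :: "'a measure \<Rightarrow> ('a \<Rightarrow> real) \<Rightarrow> real \<Rightarrow> real \<Rightarrow> bool" where
  "has_normal_law M Y m s \<longleftrightarrow>
     Y \<in> borel_measurable M \<and>
     distr M borel Y = (if s = 0 then return borel m else density lborel (normal_density m s))"

definition standard_brownian_motion ::
    "'a measure \<Rightarrow> real \<Rightarrow> (real \<Rightarrow> 'a \<Rightarrow> real) \<Rightarrow> bool" where
  "standard_brownian_motion M T W \<longleftrightarrow>
     (\<forall>t\<in>{0..T}. W t \<in> borel_measurable M) \<and>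
     (AE x in M. W 0 x = 0) \<and>
     (AE x in M. continuous_on {0..T} (\<lambda>t. W t x)) \<and>
     (\<forall>s t. 0 \<le> s \<and> s < t \<and> t \<le> T \<longrightarrow>
        has_normal_law M (\<lambda>x. W t x - W s x) 0 (sqrt (t - s))) \<and>
     (\<forall>(n::nat) (t::nat \<Rightarrow> real). 0 \<le> t 0 \<and> (\<forall>i<n. t i \<le> t (Suc i)) \<and> t n \<le> T \<longrightarrow>
        prob_space.indep_vars M (\<lambda>_. borel) (\<lambda>i x. W (t (Suc i)) x - W (t i) x) {..<n})"

definition indep_of_process ::
    "'a measure \<Rightarrow> real \<Rightarrow> ('a \<Rightarrow> real) \<Rightarrow> (real \<Rightarrow> 'a \<Rightarrow> real) \<Rightarrow> bool" where
  "indep_of_process M T Y W \<longleftrightarrow>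
     prob_space.indep_set M
       {Y -` A \<inter> space M | A. A \<in> sets borel}
       {(\<lambda>x. \<lambda>t\<in>{0..T}. W t x) -` B \<inter> space M | B. B \<in> sets (PiM {0..T} (\<lambda>_. borel :: real measure))}"

text \<open>\<open>dX\<^sub>t = \<theta> (\<mu> - X\<^sub>t) dt + \<sigma> dW\<^sub>t\<close> on \<open>[0,T]\<close> in integral form. The diffusion coefficient is
  constant, so the stochastic integral of it is \<open>\<sigma> (W\<^sub>t - W\<^sub>0) = \<sigma> W\<^sub>t\<close>.\<close>

definition solves_OU ::
    "'a measure \<Rightarrow> real \<Rightarrow> real \<Rightarrow> real \<Rightarrow> real \<Rightarrow> (real \<Rightarrow> 'a \<Rightarrow> real) \<Rightarrow> (real \<Rightarrow> 'a \<Rightarrow> real) \<Rightarrow> bool" where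
  "solves_OU M T \<theta> \<mu> \<sigma> W X \<longleftrightarrow>
     (\<forall>t\<in>{0..T}. X t \<in> borel_measurable M) \<and>
     (AE x in M. continuous_on {0..T} (\<lambda>t. X t x)) \<and>
     (AE x in M. \<forall>t\<in>{0..T}.
        X t x = X 0 x + integral {0..t} (\<lambda>s. \<theta> * (\<mu> - X s x)) + \<sigma> * W t x)"

definition cov_fun :: "'a measure \<Rightarrow> (real \<Rightarrow> 'a \<Rightarrow> real) \<Rightarrow> real \<Rightarrow> real \<Rightarrow> real" where
  "cov_fun M X s t =
     (LINT x|M. (X s x - (LINT y|M. X s y)) * (X t x - (LINT y|M. X t y)))"

text \<open>Elements of \<open>L\<^sup>2([0,T], dt)\<close> are represented by functions; equality in \<open>L\<^sup>2\<close> is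
  equality almost everywhere.\<close>

definition L2_on :: "real \<Rightarrow> (real \<Rightarrow> real) set" where
  "L2_on T = {f \<in> borel_measurable (lebesgue_on {0..T}).
                integrable (lebesgue_on {0..T}) (\<lambda>t. (f t)\<^sup>2)}"

definition L2_inner :: "real \<Rightarrow> (real \<Rightarrow> real) \<Rightarrow> (real \<Rightarrow> real) \<Rightarrow> real" where
  "L2_inner T f g = (LINT t|lebesgue_on {0..T}. f t * g t)"

definition L2_norm :: "real \<Rightarrow> (real \<Rightarrow> real) \<Rightarrow> real" where
  "L2_norm T f = sqrt (L2_inner T f f)"

definition kernel_operator ::
    "real \<Rightarrow> (real \<Rightarrow> real \<Rightarrow> real) \<Rightarrow> (real \<Rightarrow> real) \<Rightarrow> real \<Rightarrow> real" where
  "kernel_operator T k f t = (LINT s|lebesgue_on {0..T}. k s t * f s)"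

definition is_eigenvector ::
    "real \<Rightarrow> (real \<Rightarrow> real \<Rightarrow> real) \<Rightarrow> real \<Rightarrow> (real \<Rightarrow> real) \<Rightarrow> bool" where
  "is_eigenvector T k l f \<longleftrightarrow>
     f \<in> L2_on T \<and>
     \<not> (AE t in lebesgue_on {0..T}. f t = 0) \<and>
     (AE t in lebesgue_on {0..T}. kernel_operator T k f t = l * f t)"

definition orthonormal_eigenvectors ::
    "real \<Rightarrow> (real \<Rightarrow> real \<Rightarrow> real) \<Rightarrow> (nat \<Rightarrow> real \<Rightarrow> real) \<Rightarrow> (nat \<Rightarrow> real) \<Rightarrow> bool" where
  "orthonormal_eigenvectors T k e l \<longleftrightarrow>
     (\<forall>n\<ge>1. is_eigenvector T k (l n) (e n)) \<and>
     (\<forall>m\<ge>1. \<forall>n\<ge>1. L2_inner T (e m) (e n) = (if m = n then 1 else 0))"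

text \<open>Eigensystems with infinitely many non-zero eigenvalues, indexed by \<open>n \<ge> 1\<close>. The last
  conjunct says that every eigenvector for a non-zero eigenvalue lies in the linear span of the
  listed ones with that eigenvalue; given orthonormality, this is what it means that all
  non-zero eigenvalues are listed and repeated according to multiplicity.\<close>

definition KL_eigensystem ::
    "real \<Rightarrow> (real \<Rightarrow> real \<Rightarrow> real) \<Rightarrow> (nat \<Rightarrow> real \<Rightarrow> real) \<Rightarrow> (nat \<Rightarrow> real) \<Rightarrow> bool" where
  "KL_eigensystem T k e l \<longleftrightarrow>
     orthonormal_eigenvectors T k e l \<and>
     (\<forall>n\<ge>1. 0 < l n \<and> l (Suc n) \<le> l n) \<and>
     (\<forall>c f. c \<noteq> 0 \<and> is_eigenvector T k c f \<longrightarrow>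
        (\<exists>A a. finite A \<and> A \<subseteq> {n. 1 \<le> n \<and> l n = c} \<and>
           (AE t in lebesgue_on {0..T}. f t = (\<Sum>n\<in>A. a n * e n t))))"

definition OU_frequencies :: "real \<Rightarrow> real \<Rightarrow> real \<Rightarrow> real \<Rightarrow> real set" where
  "OU_frequencies T \<theta> \<sigma> \<sigma>0 =
     {\<omega>. 0 < \<omega> \<and>
        \<omega> * \<sigma>\<^sup>2 * cos (\<omega> * T) + (- \<omega>\<^sup>2 * \<sigma>0\<^sup>2 + \<theta> * \<sigma>\<^sup>2 - \<theta>\<^sup>2 * \<sigma>0\<^sup>2) * sin (\<omega> * T) = 0}"

definition OU_eigenvalue :: "real \<Rightarrow> real \<Rightarrow> real \<Rightarrow> real" where
  "OU_eigenvalue \<theta> \<sigma> \<omega> = \<sigma>\<^sup>2 / (\<omega>\<^sup>2 + \<theta>\<^sup>2)"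

definition OU_profile :: "real \<Rightarrow> real \<Rightarrow> real \<Rightarrow> real \<Rightarrow> real \<Rightarrow> real" where
  "OU_profile \<theta> \<sigma> \<sigma>0 \<omega> t =
     \<omega> * \<sigma>0\<^sup>2 * cos (\<omega> * t) + (\<sigma>\<^sup>2 - \<theta> * \<sigma>0\<^sup>2) * sin (\<omega> * t)"

text \<open>Normalization determines the constant up to sign; the positive choice is taken.\<close>

definition OU_normalization :: "real \<Rightarrow> real \<Rightarrow> real \<Rightarrow> real \<Rightarrow> real \<Rightarrow> real" where
  "OU_normalization T \<theta> \<sigma> \<sigma>0 \<omega> = 1 / L2_norm T (OU_profile \<theta> \<sigma> \<sigma>0 \<omega>)"

definition OU_eigenfunction :: "real \<Rightarrow> real \<Rightarrow> real \<Rightarrow> real \<Rightarrow> real \<Rightarrow> real \<Rightarrow> real" where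
  "OU_eigenfunction T \<theta> \<sigma> \<sigma>0 \<omega> t =
     OU_normalization T \<theta> \<sigma> \<sigma>0 \<omega> * OU_profile \<theta> \<sigma> \<sigma>0 \<omega> t"

text \<open>The frequencies give eigenvalues strictly below \<open>\<sigma>\<^sup>2 / \<theta>\<^sup>2\<close>. When \<open>\<sigma> > 0\<close>, a large initial
  variance produces one further eigenvalue, at or above \<open>\<sigma>\<^sup>2 / \<theta>\<^sup>2\<close>, whose eigenfunction is affine or
  hyperbolic instead of trigonometric; for \<open>\<theta> = T = \<sigma> = 1\<close> and \<open>\<sigma>0\<^sup>2 = 2\<close> it is
  \<open>t \<mapsto> 2 - t\<close>, with eigenvalue \<open>1\<close>. The following condition holds exactly when \<open>\<sigma> > 0\<close> and
  there is no such eigenvalue. For \<open>\<sigma> = 0\<close> the frequencies give only the eigenvalue \<open>0\<close>.\<close>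

definition OU_no_extra_eigenvalue :: "real \<Rightarrow> real \<Rightarrow> real \<Rightarrow> real \<Rightarrow> bool" where
  "OU_no_extra_eigenvalue T \<theta> \<sigma> \<sigma>0 \<longleftrightarrow> \<theta>\<^sup>2 * T * \<sigma>0\<^sup>2 < \<sigma>\<^sup>2 * (1 + \<theta> * T)"

end

theory Submission
  imports Defs
begin

text \<open>
  The process solves a linear equation with additive noise, so variation of constants gives, along
  almost every path, \<open>X\<^sub>t - E X\<^sub>t = exp (-\<theta> t) ((X\<^sub>0 - m\<^sub>0) + \<sigma> Z\<^sub>t)\<close> with
  \<open>Z\<^sub>t = exp (\<theta> t) W\<^sub>t - \<integral>\<^sub>0\<^sup>t \<theta> exp (\<theta> u) W\<^sub>u du\<close>, which is the Wiener integral of \<open>exp (\<theta> u)\<close>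
  after integration by parts. Moments of \<open>Z\<close> therefore need no stochastic integration: Fubini
  (\<open>mean_square_integral\<close>) moves the expectation inside, \<open>E (W\<^sub>s W\<^sub>t) = min s t\<close> is inserted, and the
  same elementary integral (\<open>integral_exp_min\<close>) is evaluated twice. The result
  (\<open>OU_covariance\<close>) is that the covariance has the form \<open>\<phi>(min s t) exp (-\<theta> max s t)\<close>.

  A kernel of this shape is the Green function of a Sturm-Liouville problem. Both \<open>\<phi>\<close> and
  \<open>exp (-\<theta> t)\<close> solve \<open>y'' = \<theta>\<^sup>2 y\<close>, and their Wronskian is the constant \<open>\<sigma>\<^sup>2\<close>. Hence \<open>K f = c f\<close> with
  \<open>c \<noteq> 0\<close> means \<open>f'' = (\<theta>\<^sup>2 - \<sigma>\<^sup>2/c) f\<close>, where \<open>(f(0), f'(0))\<close> is proportional to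
  \<open>(\<phi>(0), \<phi>'(0)) = (\<sigma>\<^sub>0\<^sup>2, \<sigma>\<^sup>2 - \<theta> \<sigma>\<^sub>0\<^sup>2)\<close> and \<open>f'(T) + \<theta> f(T) = 0\<close>. The profile with frequency \<open>\<omega>\<close>
  satisfies the condition at \<open>0\<close>, and the frequency equation is exactly the condition at \<open>T\<close>. So
  the profiles are eigenvectors (\<open>kernel_operator_OU_profile\<close>), and two of them are orthogonal because
  the boundary terms in Green's identity cancel (\<open>OU_profile_orthogonal\<close>).

  Conversely an eigenvector in \<open>L\<^sup>2\<close> agrees almost everywhere with its image divided by \<open>c\<close>, which is
  smooth and solves the boundary value problem. If \<open>\<theta>\<^sup>2 - \<sigma>\<^sup>2/c\<close> is negative, uniqueness for the
  initial value problem makes it a multiple of a profile. If it is nonnegative, the solution is affine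
  or hyperbolic and, under the condition on the initial variance, violates the condition at \<open>T\<close>
  (\<open>no_nontrigonometric_solution\<close>).

  The case \<open>\<sigma> = \<sigma>\<^sub>0 = 0\<close>, in which the profiles vanish, cannot occur: every positive number would be
  a frequency, and these could not be listed in a sequence.
\<close>

section \<open>Integral operators with semiseparable kernels\<close>

lemma L2_on_imp_integrable:
  assumes "f \<in> L2_on T"
  shows "integrable (lebesgue_on {0..T}) f"
proof -
  have f: "f \<in> borel_measurable (lebesgue_on {0..T})"
    and f2: "integrable (lebesgue_on {0..T}) (\<lambda>t. (f t)\<^sup>2)"
    using assms by (auto simp: L2_on_def)
  have 1: "integrable (lebesgue_on {0..T}) (\<lambda>t. 1 + (f t)\<^sup>2)"
    using f2 by (intro Bochner_Integration.integrable_add) (auto intro!: integrable_on_const)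
  show ?thesis
  proof (rule Bochner_Integration.integrable_bound[OF 1 f], rule AE_I2)
    fix t
    have "2 * \<bar>f t\<bar> \<le> 1 + (f t)\<^sup>2" using zero_le_power2[of "\<bar>f t\<bar> - 1"] 
      by (simp add: power2_eq_square algebra_simps)
    then show "norm (f t) \<le> norm (1 + (f t)\<^sup>2)" by simp
  qed
qed

lemma continuous_mult_integrable_lebesgue_on:
  fixes u f :: "real \<Rightarrow> real"
  assumes "continuous_on {a..b} u" "integrable (lebesgue_on {a..b}) f"
  shows "integrable (lebesgue_on {a..b}) (\<lambda>s. u s * f s)"
proof -
  have "(\<lambda>s. u s * f s) absolutely_integrable_on {a..b}"
  proof (rule absolutely_integrable_bounded_measurable_product_real)
    show "u \<in> borel_measurable (lebesgue_on {a..b})"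
      using assms(1) by (intro continuous_imp_measurable_on_sets_lebesgue) auto
    show "bounded (u ` {a..b})"
      using assms(1) by (intro compact_imp_bounded compact_continuous_image) auto
    show "f absolutely_integrable_on {a..b}"
      using assms(2) by (subst (asm) integrable_restrict_space) (auto simp: set_integrable_def)
  qed auto
  then show ?thesis
    by (subst integrable_restrict_space) (auto simp: set_integrable_def)
qed

lemma integral_lebesgue_on_Icc:
  fixes f :: "real \<Rightarrow> real"
  assumes "integrable (lebesgue_on {a..b}) f"
  shows "(LINT t|lebesgue_on {a..b}. f t) = integral {a..b} f" "f integrable_on {a..b}"
  using assms by (auto intro: lebesgue_integral_eq_integral integrable_on_lebesgue_on)

text \<open>Splitting the integral at \<open>t\<close> separates the variables. Only integrability of \<open>f\<close> is
  assumed, so that the formula applies to an eigenvector before its regularity is known.\<close>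

lemma kernel_operator_semiseparable:
  assumes "t \<in> {0..T}" and f: "integrable (lebesgue_on {0..T}) f"
    and u: "continuous_on {0..T} u" and v: "continuous_on {0..T} v"
    and k: "\<And>s. s \<in> {0..T} \<Longrightarrow> k s t = u (min s t) * v (max s t)"
  shows "kernel_operator T k f t =
    v t * integral {0..t} (\<lambda>s. u s * f s) + u t * integral {t..T} (\<lambda>s. v s * f s)"
proof -
  have cont: "continuous_on {0..T} (\<lambda>s. u (min s t) * v (max s t))"
    using assms(1) by (intro continuous_on_mult continuous_on_compose2[OF u] continuous_on_compose2[OF v]
      continuous_intros) auto
  note int = continuous_mult_integrable_lebesgue_on[OF cont f]
  have ui: "(\<lambda>s. u s * f s) integrable_on {0..t}"
    using integral_lebesgue_on_Icc(2)[OF continuous_mult_integrable_lebesgue_on[OF u f]] assms(1)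
    by (auto intro: integrable_on_subinterval)
  have vi: "(\<lambda>s. v s * f s) integrable_on {t..T}"
    using integral_lebesgue_on_Icc(2)[OF continuous_mult_integrable_lebesgue_on[OF v f]] assms(1)
    by (auto intro: integrable_on_subinterval)
  have "kernel_operator T k f t = (LINT s|lebesgue_on {0..T}. u (min s t) * v (max s t) * f s)"
    unfolding kernel_operator_def by (rule Bochner_Integration.integral_cong) (auto simp: k)
  also have "\<dots> = integral {0..T} (\<lambda>s. u (min s t) * v (max s t) * f s)"
    by (rule integral_lebesgue_on_Icc[OF int])
  also have "\<dots> = integral {0..t} (\<lambda>s. u (min s t) * v (max s t) * f s)
       + integral {t..T} (\<lambda>s. u (min s t) * v (max s t) * f s)"
    using assms(1) by (intro Henstock_Kurzweil_Integration.integral_combine[symmetric]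
        integral_lebesgue_on_Icc[OF int]) auto
  also have "integral {0..t} (\<lambda>s. u (min s t) * v (max s t) * f s)
      = integral {0..t} (\<lambda>s. v t * (u s * f s))"
    by (rule Henstock_Kurzweil_Integration.integral_cong) (auto simp: min_def max_def)
  also have "integral {t..T} (\<lambda>s. u (min s t) * v (max s t) * f s)
      = integral {t..T} (\<lambda>s. u t * (v s * f s))"
    by (rule Henstock_Kurzweil_Integration.integral_cong) (auto simp: min_def max_def)
  finally show ?thesis using ui vi by simp
qed

section \<open>The profiles as eigenvectors\<close>

text \<open>The covariance at times \<open>s \<le> t\<close> is \<open>OU_phi s * exp (-\<theta> t)\<close>. This factor is the solution of
  \<open>y'' = \<theta>\<^sup>2 y\<close> whose value and slope at \<open>0\<close> every eigenfunction for a nonzero eigenvalue shares up to a factor.\<close>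

definition OU_phi :: "real \<Rightarrow> real \<Rightarrow> real \<Rightarrow> real \<Rightarrow> real" where
  "OU_phi \<theta> \<sigma> \<sigma>0 t = \<sigma>\<^sup>2 / \<theta> * sinh (\<theta> * t) + \<sigma>0\<^sup>2 * exp (- \<theta> * t)"

definition OU_phi' :: "real \<Rightarrow> real \<Rightarrow> real \<Rightarrow> real \<Rightarrow> real" where
  "OU_phi' \<theta> \<sigma> \<sigma>0 t = \<sigma>\<^sup>2 * cosh (\<theta> * t) - \<theta> * \<sigma>0\<^sup>2 * exp (- \<theta> * t)"

lemma OU_phi_deriv:
  assumes "\<theta> \<noteq> 0"
  shows "(OU_phi \<theta> \<sigma> \<sigma>0 has_real_derivative OU_phi' \<theta> \<sigma> \<sigma>0 t) (at t within S)"
    and "(OU_phi' \<theta> \<sigma> \<sigma>0 has_real_derivative \<theta>\<^sup>2 * OU_phi \<theta> \<sigma> \<sigma>0 t) (at t within S)"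
  unfolding OU_phi_def[abs_def] OU_phi'_def[abs_def] using assms
  by (auto intro!: derivative_eq_intros simp: field_simps power2_eq_square)

lemma OU_phi_Wronskian: "\<theta> \<noteq> 0 \<Longrightarrow>
   OU_phi' \<theta> \<sigma> \<sigma>0 t + \<theta> * OU_phi \<theta> \<sigma> \<sigma>0 t = \<sigma>\<^sup>2 * exp (\<theta> * t)"
  unfolding OU_phi_def OU_phi'_def by (simp add: sinh_def cosh_def field_simps)

definition OU_slope :: "real \<Rightarrow> real \<Rightarrow> real \<Rightarrow> real \<Rightarrow> real \<Rightarrow> real" where
  "OU_slope \<theta> \<sigma> \<sigma>0 \<omega> t =
     - \<omega>\<^sup>2 * \<sigma>0\<^sup>2 * sin (\<omega> * t) + \<omega> * (\<sigma>\<^sup>2 - \<theta> * \<sigma>0\<^sup>2) * cos (\<omega> * t)"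

lemma OU_profile_deriv:
  "(OU_profile \<theta> \<sigma> \<sigma>0 \<omega> has_real_derivative OU_slope \<theta> \<sigma> \<sigma>0 \<omega> t) (at t within S)"
  "(OU_slope \<theta> \<sigma> \<sigma>0 \<omega> has_real_derivative - \<omega>\<^sup>2 * OU_profile \<theta> \<sigma> \<sigma>0 \<omega> t) (at t within S)"
  unfolding OU_profile_def[abs_def] OU_slope_def[abs_def]
  by (auto intro!: derivative_eq_intros simp: field_simps power2_eq_square)

lemma OU_profile_continuous: "continuous_on S (OU_profile \<theta> \<sigma> \<sigma>0 \<omega>)"
  unfolding OU_profile_def[abs_def] by (intro continuous_intros)

text \<open>The frequency equation is the boundary condition at \<open>T\<close> that every function in the range of
  the covariance operator satisfies.\<close>

lemma OU_frequency_iff: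
  "\<omega> \<in> OU_frequencies T \<theta> \<sigma> \<sigma>0 \<longleftrightarrow>
     0 < \<omega> \<and> OU_slope \<theta> \<sigma> \<sigma>0 \<omega> T + \<theta> * OU_profile \<theta> \<sigma> \<sigma>0 \<omega> T = 0"
  unfolding OU_frequencies_def OU_slope_def OU_profile_def
  by (simp add: algebra_simps power2_eq_square)

lemma integral_real_derivative:
  fixes F F' :: "real \<Rightarrow> real"
  assumes "a \<le> b" "\<And>t. t \<in> {a..b} \<Longrightarrow> (F has_real_derivative F' t) (at t within {a..b})"
  shows "integral {a..b} F' = F b - F a"
  using assms by (intro integral_unique fundamental_theorem_of_calculus)
    (auto simp: has_real_derivative_iff_has_vector_derivative)

text \<open>Green's identity against each of the two solutions of \<open>y'' = \<theta>\<^sup>2 y\<close> evaluates the two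
  integrals; the boundary term at \<open>T\<close> vanishes by the frequency equation, the one at \<open>0\<close> by the
  initial data of the profile. What remains is the Wronskian times the profile.\<close>

lemma kernel_operator_OU_profile:
  assumes "\<theta> > 0" "t \<in> {0..T}" and om: "\<omega> \<in> OU_frequencies T \<theta> \<sigma> \<sigma>0"
    and k: "\<And>s. s \<in> {0..T} \<Longrightarrow> k s t = OU_phi \<theta> \<sigma> \<sigma>0 (min s t) * exp (- \<theta> * max s t)"
  shows "kernel_operator T k (OU_profile \<theta> \<sigma> \<sigma>0 \<omega>) t
      = OU_eigenvalue \<theta> \<sigma> \<omega> * OU_profile \<theta> \<sigma> \<sigma>0 \<omega> t"
proof -
  let ?f = "OU_profile \<theta> \<sigma> \<sigma>0 \<omega>" and ?f' = "OU_slope \<theta> \<sigma> \<sigma>0 \<omega>"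
  let ?p = "OU_phi \<theta> \<sigma> \<sigma>0" and ?p' = "OU_phi' \<theta> \<sigma> \<sigma>0"
  let ?d = "\<omega>\<^sup>2 + \<theta>\<^sup>2"
  have d: "?d > 0" using assms(1) by (simp add: add_nonneg_pos)
  have bT: "?f' T + \<theta> * ?f T = 0" using om by (simp add: OU_frequency_iff)
  have [simp]: "\<theta> \<noteq> 0" using assms(1) by simp
  have int: "integrable (lebesgue_on {0..T}) ?f"
    by (rule continuous_imp_integrable_real[OF OU_profile_continuous])
  have cp: "continuous_on {0..T} ?p"
    by (rule DERIV_continuous_on[OF OU_phi_deriv(1)[OF \<open>\<theta> \<noteq> 0\<close>]])
  have cv: "continuous_on {0..T} (\<lambda>s. exp (- \<theta> * s))" by (intro continuous_intros)
  have "integral {t..T} (\<lambda>s. - ?d * (exp (- \<theta> * s) * ?f s))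
     = exp (- \<theta> * T) * (?f' T + \<theta> * ?f T) - exp (- \<theta> * t) * (?f' t + \<theta> * ?f t)"
    using assms(2)
    by (intro integral_real_derivative)
      (auto intro!: derivative_eq_intros OU_profile_deriv simp: algebra_simps power2_eq_square)
  then have I1: "?d * integral {t..T} (\<lambda>s. exp (- \<theta> * s) * ?f s) = exp (- \<theta> * t) * (?f' t + \<theta> * ?f t)"
    unfolding bT Henstock_Kurzweil_Integration.integral_mult_right by linarith
  have "integral {0..t} (\<lambda>s. - ?d * (?p s * ?f s))
     = (?p t * ?f' t - ?p' t * ?f t) - (?p 0 * ?f' 0 - ?p' 0 * ?f 0)"
    using assms(2)
    by (intro integral_real_derivative)
      (auto intro!: derivative_eq_intros OU_profile_deriv OU_phi_deriv simp: algebra_simps power2_eq_square)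
  moreover have "?p 0 * ?f' 0 - ?p' 0 * ?f 0 = 0"
    by (simp add: OU_phi_def OU_phi'_def OU_profile_def OU_slope_def)
  ultimately have I2: "?d * integral {0..t} (\<lambda>s. ?p s * ?f s) = - (?p t * ?f' t - ?p' t * ?f t)"
    unfolding Henstock_Kurzweil_Integration.integral_mult_right by linarith
  have "?d * kernel_operator T k ?f t =
      exp (- \<theta> * t) * (?d * integral {0..t} (\<lambda>s. ?p s * ?f s)) 
      + ?p t * (?d * integral {t..T} (\<lambda>s. exp (- \<theta> * s) * ?f s))"
    by (subst kernel_operator_semiseparable[OF assms(2) int cp cv]) (auto simp: k algebra_simps)
  also have "\<dots> = exp (- \<theta> * t) * ((?p' t + \<theta> * ?p t) * ?f t)"
    unfolding I1 I2 by (simp add: algebra_simps)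
  also have "\<dots> = \<sigma>\<^sup>2 * ?f t"
    by (simp add: OU_phi_Wronskian flip: exp_add)
  finally show ?thesis using d by (simp add: OU_eigenvalue_def field_simps)
qed

text \<open>Orthogonality comes from the boundary conditions rather than from distinct eigenvalues of a
  symmetric operator, since for \<open>\<sigma> = 0\<close> all the eigenvalues are \<open>0\<close>.\<close>

lemma OU_profile_orthogonal:
  assumes "T > 0" and om: "\<omega> \<in> OU_frequencies T \<theta> \<sigma> \<sigma>0" and om': "\<omega>' \<in> OU_frequencies T \<theta> \<sigma> \<sigma>0"
    and "\<omega> \<noteq> \<omega>'"
  shows "L2_inner T (OU_profile \<theta> \<sigma> \<sigma>0 \<omega>) (OU_profile \<theta> \<sigma> \<sigma>0 \<omega>') = 0"
proof -
  let ?f = "OU_profile \<theta> \<sigma> \<sigma>0 \<omega>" and ?f' = "OU_slope \<theta> \<sigma> \<sigma>0 \<omega>"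
  let ?g = "OU_profile \<theta> \<sigma> \<sigma>0 \<omega>'" and ?g' = "OU_slope \<theta> \<sigma> \<sigma>0 \<omega>'"
  have "L2_inner T ?f ?g = integral {0..T} (\<lambda>t. ?f t * ?g t)"
    unfolding L2_inner_def
    by (intro integral_lebesgue_on_Icc continuous_imp_integrable_real continuous_on_mult
        OU_profile_continuous)
  moreover have "integral {0..T} (\<lambda>t. (\<omega>\<^sup>2 - \<omega>'\<^sup>2) * (?f t * ?g t))
     = (?f T * ?g' T - ?f' T * ?g T) - (?f 0 * ?g' 0 - ?f' 0 * ?g 0)"
    using assms(1)
    by (intro integral_real_derivative)
      (auto intro!: derivative_eq_intros OU_profile_deriv simp: algebra_simps power2_eq_square)
  moreover have "?f T * ?g' T - ?f' T * ?g T = 0"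
  proof -
    have "?f' T = - \<theta> * ?f T" "?g' T = - \<theta> * ?g T"
      using om om' by (auto simp: OU_frequency_iff)
    then show ?thesis by simp
  qed
  moreover have "?f 0 * ?g' 0 - ?f' 0 * ?g 0 = 0"
    by (simp add: OU_profile_def OU_slope_def)
  moreover have "\<omega>\<^sup>2 - \<omega>'\<^sup>2 \<noteq> 0"
    using om om' assms(4) by (auto simp: OU_frequency_iff)
  ultimately show ?thesis by simp
qed

lemma OU_profile_L2_norm_pos:
  assumes "T > 0" "\<omega> > 0" "(\<sigma>, \<sigma>0) \<noteq> (0, 0)"
  shows "L2_inner T (OU_profile \<theta> \<sigma> \<sigma>0 \<omega>) (OU_profile \<theta> \<sigma> \<sigma>0 \<omega>) > 0"
proof -
  let ?f = "OU_profile \<theta> \<sigma> \<sigma>0 \<omega>"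
  have c: "continuous_on {0..T} (\<lambda>t. ?f t * ?f t)" 
    by (intro continuous_on_mult OU_profile_continuous)
  have L: "L2_inner T ?f ?f = integral {0..T} (\<lambda>t. ?f t * ?f t)"
    unfolding L2_inner_def
    by (intro integral_lebesgue_on_Icc continuous_imp_integrable_real c)
  have "L2_inner T ?f ?f \<ge> 0" unfolding L by (rule integral_nonneg) (auto intro: integrable_continuous_real c)
  moreover have "L2_inner T ?f ?f \<noteq> 0"
  proof
    assume "L2_inner T ?f ?f = 0"
    then have "((\<lambda>t. ?f t * ?f t) has_integral 0) (cbox 0 T)"
      unfolding L using integrable_integral[OF integrable_continuous_real[OF c]] by simp
    then have z: "?f t = 0" if "t \<in> {0..T}" for t
      using has_integral_0_cbox_imp_0[of 0 T "\<lambda>t. ?f t * ?f t" t] c assms(1) that by auto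
    from z[of 0] assms have "\<sigma>0 = 0" by (auto simp: OU_profile_def)
    moreover define t where "t = min T (pi / (2 * \<omega>))"
    have t: "t \<in> {0..T}" "t > 0" "\<omega> * t \<le> pi / 2" using assms
      by (auto simp: t_def min_def field_simps)
    have "sin (\<omega> * t) > 0" 
    proof (rule sin_gt_zero)
      show "\<omega> * t < pi" using t(3) pi_gt_zero by linarith
    qed (use t assms in auto)
    ultimately show False using z[OF t(1)] assms by (auto simp: OU_profile_def)
  qed
  ultimately show ?thesis by simp
qed

lemma OU_profile_L2_norm:
  assumes "T > 0" "\<omega> > 0"
  shows "L2_inner T (OU_profile \<theta> \<sigma> \<sigma>0 \<omega>) (OU_profile \<theta> \<sigma> \<sigma>0 \<omega>) =
       1 / 2 * \<sigma>0\<^sup>2 * (\<sigma>\<^sup>2 - \<theta> * \<sigma>0\<^sup>2) * (1 - cos (2 * \<omega> * T))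
             + 1 / 2 * \<sigma>0 ^ 4 * \<omega>\<^sup>2 * (T + sin (2 * \<omega> * T) / (2 * \<omega>))
             + 1 / 2 * (\<sigma>\<^sup>2 - \<theta> * \<sigma>0\<^sup>2)\<^sup>2 * (T - sin (2 * \<omega> * T) / (2 * \<omega>))"
proof -
  let ?f = "OU_profile \<theta> \<sigma> \<sigma>0 \<omega>"
  define a where "a = \<omega> * \<sigma>0\<^sup>2"
  define b where "b = \<sigma>\<^sup>2 - \<theta> * \<sigma>0\<^sup>2"
  define F where "F = (\<lambda>t. a * b / \<omega> * (1 - cos (2 * \<omega> * t)) / 2 + a\<^sup>2 / 2 * (t + sin (2 * \<omega> * t) / (2 * \<omega>))
      + b\<^sup>2 / 2 * (t - sin (2 * \<omega> * t) / (2 * \<omega>)))"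
  have D: "(F has_real_derivative (?f t * ?f t)) (at t within {0..T})" for t
  proof -
    have *: "?f t * ?f t = a * b * sin (2 * (\<omega> * t)) + a\<^sup>2 / 2 * (1 + cos (2 * (\<omega> * t)))
       + b\<^sup>2 / 2 * (1 - cos (2 * (\<omega> * t)))"
    proof -
      have s: "sin (\<omega> * t) * sin (\<omega> * t) = 1 - cos (\<omega> * t) * cos (\<omega> * t)"
        using sin_cos_squared_add[of "\<omega> * t"] by (simp add: power2_eq_square)
      have fd: "?f t = a * cos (\<omega> * t) + b * sin (\<omega> * t)"
        by (simp add: OU_profile_def a_def b_def)
      show ?thesis
        unfolding fd cos_double_cos sin_double
        using s by (simp add: power2_eq_square) algebra
    qed
    show ?thesis unfolding F_def * using assms
      by (auto intro!: derivative_eq_intros simp: field_simps power2_eq_square)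
  qed
  have "L2_inner T ?f ?f = integral {0..T} (\<lambda>t. ?f t * ?f t)"
    unfolding L2_inner_def
    by (intro integral_lebesgue_on_Icc continuous_imp_integrable_real continuous_on_mult
        OU_profile_continuous)
  also have "\<dots> = F T - F 0" using assms by (intro integral_real_derivative D) auto
  also have "F 0 = 0" by (simp add: F_def)
  finally show ?thesis using assms unfolding F_def a_def b_def
    by (simp add: power_mult_distrib)
qed

section \<open>All eigenvectors for nonzero eigenvalues\<close>

text \<open>The energy \<open>h\<^sup>2 + h1\<^sup>2\<close> grows at most at rate \<open>1 + \<bar>q\<bar>\<close>, whatever the sign of \<open>q\<close>, and starts
  at \<open>0\<close>.\<close>

lemma linear_ode2_zero:
  fixes h h1 :: "real \<Rightarrow> real"
  assumes h: "\<And>t. t \<in> {0..T} \<Longrightarrow> (h has_real_derivative h1 t) (at t within {0..T})"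
    and h1: "\<And>t. t \<in> {0..T} \<Longrightarrow> (h1 has_real_derivative q * h t) (at t within {0..T})"
    and init: "h 0 = 0" "h1 0 = 0" and t: "t \<in> {0..T}"
  shows "h t = 0" "h1 t = 0"
proof -
  define C where "C = 1 + \<bar>q\<bar>"
  define E where "E = (\<lambda>s. exp (- C * s) * ((h s)\<^sup>2 + (h1 s)\<^sup>2))"
  have ch: "continuous_on {0..T} h" by (rule DERIV_continuous_on[OF h])
  have ch1: "continuous_on {0..T} h1" by (rule DERIV_continuous_on[OF h1])
  have "E 0 \<ge> E t"
  proof (rule DERIV_nonpos_imp_decreasing_open[where f = E and a = 0 and b = t])
    show "0 \<le> t" using t by simp
    fix x assume x: "0 < x" "x < t"
    then have i: "at x within {0..T} = at x" using t by (intro at_within_interior) auto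
    have D: "(h has_real_derivative h1 x) (at x)" "(h1 has_real_derivative q * h x) (at x)"
      using h[of x] h1[of x] x t by (auto simp: i)
    have *: "(E has_real_derivative exp (- C * x) *
       (2 * (1 + q) * (h x * h1 x) - C * ((h x)\<^sup>2 + (h1 x)\<^sup>2))) (at x)"
      unfolding E_def by (auto intro!: derivative_eq_intros D simp: algebra_simps)
    have "2 * (1 + q) * (h x * h1 x) \<le> \<bar>2 * (1 + q) * (h x * h1 x)\<bar>" by (rule abs_ge_self)
    also have "\<dots> = \<bar>1 + q\<bar> * (2 * (\<bar>h x\<bar> * \<bar>h1 x\<bar>))" by (simp only: abs_mult)
    also have "\<dots> \<le> C * ((h x)\<^sup>2 + (h1 x)\<^sup>2)"
    proof (rule mult_mono)
      show "2 * (\<bar>h x\<bar> * \<bar>h1 x\<bar>) \<le> (h x)\<^sup>2 + (h1 x)\<^sup>2"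
        using sum_squares_bound[of "\<bar>h x\<bar>" "\<bar>h1 x\<bar>"] by (simp add: algebra_simps)
    qed (auto simp: C_def)
    finally show "\<exists>y. (E has_real_derivative y) (at x) \<and> y \<le> 0"
      using * by (intro exI[of _ "exp (- C * x) *
       (2 * (1 + q) * (h x * h1 x) - C * ((h x)\<^sup>2 + (h1 x)\<^sup>2))"]) (auto simp: mult_le_0_iff)
  next
    show "continuous_on {0..t} E" unfolding E_def
      using t by (intro continuous_intros continuous_on_subset[OF ch] continuous_on_subset[OF ch1]) auto
  qed
  then have "(h t)\<^sup>2 + (h1 t)\<^sup>2 \<le> 0" using init by (simp add: E_def mult_le_0_iff)
  then show "h t = 0" "h1 t = 0" by (auto simp: sum_power2_le_zero_iff)
qed

lemma sinh_le_x_cosh: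
  assumes "0 \<le> (x::real)"
  shows "sinh x \<le> x * cosh x"
proof -
  have "0 * cosh 0 - sinh 0 \<le> x * cosh x - sinh x"
  proof (rule DERIV_nonneg_imp_nondecreasing[OF assms])
    fix y :: real assume "0 \<le> y"
    then show "\<exists>d. ((\<lambda>x. x * cosh x - sinh x) has_real_derivative d) (at y) \<and> d \<ge> 0"
      by (intro exI[of _ "y * sinh y"]) (auto intro!: derivative_eq_intros)
  qed
  then show ?thesis by simp
qed

text \<open>The value of \<open>h' + \<theta> h\<close> at \<open>T\<close> is \<open>b\<close> times an expression in \<open>\<kappa> = sqrt q\<close>. Bounding
  \<open>\<kappa> T cosh (\<kappa> T)\<close> below by \<open>sinh (\<kappa> T)\<close> reduces its positivity to the limit \<open>\<kappa> = 0\<close>, the affine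
  case, where it is the assumption on the initial variance.\<close>

lemma no_nontrigonometric_solution:
  assumes "T > 0" "\<theta> > 0" and ne: "OU_no_extra_eigenvalue T \<theta> \<sigma> \<sigma>0" and "q \<ge> 0"
    and h: "\<And>t. t \<in> {0..T} \<Longrightarrow> (h has_real_derivative h1 t) (at t within {0..T})"
    and h1: "\<And>t. t \<in> {0..T} \<Longrightarrow> (h1 has_real_derivative q * h t) (at t within {0..T})"
    and init: "h 0 = \<sigma>0\<^sup>2 * b" "h1 0 = (\<sigma>\<^sup>2 - \<theta> * \<sigma>0\<^sup>2) * b"
    and bT: "h1 T + \<theta> * h T = 0"
  shows "b = 0"
proof -
  define a where "a = \<sigma>0\<^sup>2"
  define d where "d = \<sigma>\<^sup>2 - \<theta> * a"
  define K where "K = sqrt q"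
  have K: "K \<ge> 0" "q = K\<^sup>2" using assms(4) by (auto simp: K_def)
  define p where "p = (\<lambda>t. if K = 0 then a + d * t else a * cosh (K * t) + d / K * sinh (K * t))"
  define p1 where "p1 = (\<lambda>t. if K = 0 then d else a * K * sinh (K * t) + d * cosh (K * t))"
  have p: "(p has_real_derivative p1 t) (at t within {0..T})" for t
    unfolding p_def p1_def by (cases "K = 0") (auto intro!: derivative_eq_intros simp: field_simps)
  have p1: "(p1 has_real_derivative q * p t) (at t within {0..T})" for t
    unfolding p_def p1_def K by (cases "K = 0") (auto intro!: derivative_eq_intros simp: field_simps power2_eq_square)
  have ne': "\<theta>\<^sup>2 * T * a < \<sigma>\<^sup>2 * (1 + \<theta> * T)"
    using ne by (simp add: OU_no_extra_eigenvalue_def a_def)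
  have pos: "p1 T + \<theta> * p T > 0"
  proof (cases "K = 0")
    case True
    have "p1 T + \<theta> * p T = \<sigma>\<^sup>2 * (1 + \<theta> * T) - \<theta>\<^sup>2 * T * a"
      using True by (simp add: p_def p1_def d_def algebra_simps power2_eq_square)
    then show ?thesis using ne' by simp
  next
    case False
    then have K0: "K > 0" using K by simp
    let ?s = "sinh (K * T)"
    have s: "?s > 0" using K0 assms(1) by (simp add: sinh_real_pos_iff)
    have "0 < (\<sigma>\<^sup>2 * (1 + \<theta> * T) - \<theta>\<^sup>2 * T * a + T * a * K\<^sup>2) * ?s"
      using s ne' assms(1) by (intro mult_pos_pos add_pos_nonneg) (auto simp: a_def)
    also have "\<dots> = \<sigma>\<^sup>2 * ?s + T * (a * K\<^sup>2 + \<theta> * \<sigma>\<^sup>2 - \<theta>\<^sup>2 * a) * ?s"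
      by (simp add: algebra_simps)
    also have "\<dots> \<le> \<sigma>\<^sup>2 * (K * T * cosh (K * T)) + T * (a * K\<^sup>2 + \<theta> * \<sigma>\<^sup>2 - \<theta>\<^sup>2 * a) * ?s"
      using sinh_le_x_cosh[of "K * T"] K0 assms(1) by (intro add_right_mono mult_left_mono) auto
    also have "\<dots> = K * T * (p1 T + \<theta> * p T)"
      using False by (simp add: p_def p1_def d_def field_simps power2_eq_square)
    finally have "K * T * (p1 T + \<theta> * p T) > 0" .
    moreover have "K * T > 0" using K0 assms(1) by simp
    ultimately show ?thesis by (metis zero_less_mult_pos)
  qed
  have T: "T \<in> {0..T}" using assms(1) by simp
  have 1: "((\<lambda>t. h t - b * p t) has_real_derivative h1 t - b * p1 t) (at t within {0..T})"
    if "t \<in> {0..T}" for t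
    by (auto intro!: derivative_eq_intros h p that)
  have 2: "((\<lambda>t. h1 t - b * p1 t) has_real_derivative q * (h t - b * p t)) (at t within {0..T})"
    if "t \<in> {0..T}" for t
    by (rule derivative_eq_intros h1 p1 that refl)+ (simp add: algebra_simps)
  have 3: "h 0 - b * p 0 = 0" "h1 0 - b * p1 0 = 0"
    using init by (auto simp: p_def p1_def a_def d_def)
  have "h T - b * p T = 0" "h1 T - b * p1 T = 0"
    using linear_ode2_zero[OF 1 2 3 T] by auto
  then have "b * (p1 T + \<theta> * p T) = 0" using bT by (simp add: algebra_simps)
  then show "b = 0" using pos by simp
qed

text \<open>Dividing the image \<open>K f\<close> by \<open>c\<close> gives a continuous representative \<open>h\<close> of \<open>f\<close> that solves
  \<open>K h = c h\<close> everywhere. Differentiating this equation twice gives the differential equation, and its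
  values at the end points give the boundary conditions.\<close>

lemma OU_eigenvector_is_profile:
  assumes "T > 0" "\<theta> > 0" and ne: "OU_no_extra_eigenvalue T \<theta> \<sigma> \<sigma>0" and "c \<noteq> 0"
    and ev: "is_eigenvector T k c f"
    and k: "\<And>s t. s \<in> {0..T} \<Longrightarrow> t \<in> {0..T} \<Longrightarrow>
             k s t = OU_phi \<theta> \<sigma> \<sigma>0 (min s t) * exp (- \<theta> * max s t)"
  shows "\<exists>\<omega>\<in>OU_frequencies T \<theta> \<sigma> \<sigma>0. c = OU_eigenvalue \<theta> \<sigma> \<omega> \<and>
           (\<exists>b. AE t in lebesgue_on {0..T}. f t = b * OU_profile \<theta> \<sigma> \<sigma>0 \<omega> t)"
proof -
  let ?p = "OU_phi \<theta> \<sigma> \<sigma>0" and ?p' = "OU_phi' \<theta> \<sigma> \<sigma>0"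
  let ?a = "\<sigma>0\<^sup>2" and ?d = "\<sigma>\<^sup>2 - \<theta> * \<sigma>0\<^sup>2"
  have \<theta>0: "\<theta> \<noteq> 0" using assms by simp
  have f: "integrable (lebesgue_on {0..T}) f"
    using ev by (auto simp: is_eigenvector_def intro: L2_on_imp_integrable)
  have fAE: "AE t in lebesgue_on {0..T}. kernel_operator T k f t = c * f t"
    using ev by (simp add: is_eigenvector_def)
  have cp: "continuous_on {0..T} ?p"
    by (rule DERIV_continuous_on[OF OU_phi_deriv(1)[OF \<theta>0]])
  have cv: "continuous_on {0..T} (\<lambda>s. exp (- \<theta> * s))" by (intro continuous_intros)
  have Kop: "kernel_operator T k g t = exp (- \<theta> * t) * integral {0..t} (\<lambda>s. ?p s * g s)
       + ?p t * integral {t..T} (\<lambda>s. exp (- \<theta> * s) * g s)"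
    if "integrable (lebesgue_on {0..T}) g" "t \<in> {0..T}" for g t
    by (rule kernel_operator_semiseparable[OF that(2,1) cp cv]) (rule k[OF _ that(2)])
  define h where "h = (\<lambda>t. kernel_operator T k f t / c)"
  have ch: "continuous_on {0..T} h"
  proof -
    have "continuous_on {0..T} (\<lambda>t. (exp (- \<theta> * t) * integral {0..t} (\<lambda>s. ?p s * f s)
       + ?p t * integral {t..T} (\<lambda>s. exp (- \<theta> * s) * f s)) / c)"
      using assms(4) by (intro continuous_intros cp indefinite_integral_continuous_1 indefinite_integral_continuous_1'
          integral_lebesgue_on_Icc continuous_mult_integrable_lebesgue_on cv f) auto
    then show ?thesis unfolding h_def
      by (rule continuous_on_eq) (simp add: Kop[OF f])
  qed
  have hint: "integrable (lebesgue_on {0..T}) h"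
    by (rule continuous_imp_integrable_real[OF ch])
  have hf: "AE t in lebesgue_on {0..T}. f t = h t"
    using fAE by eventually_elim (use assms(4) in \<open>simp add: h_def\<close>)
  have Kh: "kernel_operator T k f t = kernel_operator T k h t" if t: "t \<in> {0..T}" for t
  proof -
    have ck: "continuous_on {0..T} (\<lambda>s. ?p (min s t) * exp (- \<theta> * max s t))"
      using t by (intro continuous_intros continuous_on_compose2[OF cp]) auto
    have "integrable (lebesgue_on {0..T}) (\<lambda>s. k s t * g s) \<longleftrightarrow>
          integrable (lebesgue_on {0..T}) (\<lambda>s. ?p (min s t) * exp (- \<theta> * max s t) * g s)" for g
      using t by (intro Bochner_Integration.integrable_cong) (auto simp: k)
    then have "integrable (lebesgue_on {0..T}) (\<lambda>s. k s t * g s)"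
      if "integrable (lebesgue_on {0..T}) g" for g
      using continuous_mult_integrable_lebesgue_on[OF ck that] by simp
    then show ?thesis unfolding kernel_operator_def
      using f hint hf by (intro integral_cong_AE) (auto elim: eventually_mono)
  qed
  define A where "A = (\<lambda>t. integral {0..t} (\<lambda>s. ?p s * h s))"
  define B where "B = (\<lambda>t. integral {t..T} (\<lambda>s. exp (- \<theta> * s) * h s))"
  have hAB: "h t = (exp (- \<theta> * t) * A t + ?p t * B t) / c" if "t \<in> {0..T}" for t
    using Kop[OF hint that] Kh[OF that] by (simp add: h_def A_def B_def)
  have dA: "(A has_real_derivative ?p t * h t) (at t within {0..T})" if "t \<in> {0..T}" for t
    unfolding A_def by (rule integral_has_real_derivative[OF continuous_on_mult[OF cp ch] that])
  have dB: "(B has_real_derivative - (exp (- \<theta> * t) * h t)) (at t within {0..T})" if "t \<in> {0..T}" for t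
    unfolding B_def by (rule integral_has_real_derivative'[OF continuous_on_mult[OF cv ch] that])
  define h1 where "h1 = (\<lambda>t. (- \<theta> * exp (- \<theta> * t) * A t + ?p' t * B t) / c)"
  define q where "q = \<theta>\<^sup>2 - \<sigma>\<^sup>2 / c"
  have dh: "(h has_real_derivative h1 t) (at t within {0..T})" if t: "t \<in> {0..T}" for t
  proof -
    have *: "((\<lambda>t. (exp (- \<theta> * t) * A t + ?p t * B t) / c) has_real_derivative h1 t) (at t within {0..T})"
      unfolding h1_def using assms(4) t
      by (auto intro!: derivative_eq_intros dA dB OU_phi_deriv \<theta>0 simp: field_simps)
    show ?thesis
      using has_derivative_transform[OF t hAB *[unfolded has_field_derivative_def]]
      by (simp add: has_field_derivative_def)
  qed
  have dh1: "(h1 has_real_derivative q * h t) (at t within {0..T})" if t: "t \<in> {0..T}" for t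
  proof -
    let ?e = "exp (- \<theta> * t)"
    have "(h1 has_real_derivative (\<theta>\<^sup>2 * (?e * A t + ?p t * B t)
         - ?e * (?p' t + \<theta> * ?p t) * h t) / c) (at t within {0..T})"
      unfolding h1_def using assms(4) t
      by (auto intro!: derivative_eq_intros dA dB OU_phi_deriv \<theta>0 simp: field_simps power2_eq_square)
    also have "?e * (?p' t + \<theta> * ?p t) = \<sigma>\<^sup>2"
      unfolding OU_phi_Wronskian[OF \<theta>0] by (simp flip: exp_add)
    also have "?e * A t + ?p t * B t = c * h t"
      using hAB[OF t] assms(4) by simp
    also have "(\<theta>\<^sup>2 * (c * h t) - \<sigma>\<^sup>2 * h t) / c = q * h t"
      using assms(4) by (simp add: q_def field_simps)
    finally show ?thesis .
  qed
  have T: "0 \<in> {0..T}" "T \<in> {0..T}" using assms(1) by auto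
  have A0: "A 0 = 0" and BT: "B T = 0" by (auto simp: A_def B_def)
  define b where "b = B 0 / c"
  have init: "h 0 = ?a * b" "h1 0 = ?d * b"
    unfolding hAB[OF T(1)] h1_def A0 b_def by (simp_all add: OU_phi_def OU_phi'_def)
  have bT: "h1 T + \<theta> * h T = 0"
    unfolding hAB[OF T(2)] h1_def BT using assms(4) by (simp add: field_simps)
  \<comment> \<open>If the initial data vanish, so does the eigenvector.\<close>
  have b0: "b \<noteq> 0"
  proof
    assume "b = 0"
    then have hz: "h t = 0" if "t \<in> {0..T}" for t
      using linear_ode2_zero(1)[OF dh dh1 _ _ that] init by simp
    have "AE t in lebesgue_on {0..T}. f t = 0"
      using hf AE_space[of "lebesgue_on {0..T}"] by eventually_elim (simp add: hz)
    then show False using ev by (simp add: is_eigenvector_def)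
  qed
  have "q < 0"
    using no_nontrigonometric_solution[OF assms(1,2) ne _ dh dh1 init bT] b0 by force
  define \<omega> where "\<omega> = sqrt (- q)"
  have om: "\<omega> > 0" "\<omega>\<^sup>2 = - q" using \<open>q < 0\<close> by (auto simp: \<omega>_def)
  define r where "r = b / \<omega>"
  let ?P = "OU_profile \<theta> \<sigma> \<sigma>0 \<omega>" and ?P' = "OU_slope \<theta> \<sigma> \<sigma>0 \<omega>"
  have eq: "h t - r * ?P t = 0" "h1 t - r * ?P' t = 0" if t: "t \<in> {0..T}" for t
  proof -
    have 1: "((\<lambda>t. h t - r * ?P t) has_real_derivative h1 t - r * ?P' t) (at t within {0..T})"
      if "t \<in> {0..T}" for t
      by (auto intro!: derivative_eq_intros dh OU_profile_deriv that)
    have 2: "((\<lambda>t. h1 t - r * ?P' t) has_real_derivative q * (h t - r * ?P t)) (at t within {0..T})"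
      if "t \<in> {0..T}" for t
      by (rule derivative_eq_intros dh1 OU_profile_deriv that refl)+ (simp add: om algebra_simps)
    have 3: "h 0 - r * ?P 0 = 0" "h1 0 - r * ?P' 0 = 0"
      using om(1) init by (auto simp: OU_profile_def OU_slope_def r_def)
    show "h t - r * ?P t = 0" "h1 t - r * ?P' t = 0"
      using linear_ode2_zero[OF 1 2 3 t] by auto
  qed
  have "r * (?P' T + \<theta> * ?P T) = 0"
    using bT eq[OF T(2)] by (simp add: algebra_simps)
  moreover have "r \<noteq> 0" using b0 om(1) by (simp add: r_def)
  ultimately have "\<omega> \<in> OU_frequencies T \<theta> \<sigma> \<sigma>0"
    using om(1) by (simp only: OU_frequency_iff mult_eq_0_iff) simp
  moreover have "c = OU_eigenvalue \<theta> \<sigma> \<omega>"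
  proof -
    have "\<omega>\<^sup>2 + \<theta>\<^sup>2 = \<sigma>\<^sup>2 / c" using om(2) by (simp add: q_def)
    moreover have "\<omega>\<^sup>2 + \<theta>\<^sup>2 > 0" using om(1) by (simp add: add_pos_nonneg)
    ultimately show ?thesis using assms(4) by (auto simp: OU_eigenvalue_def)
  qed
  moreover have "AE t in lebesgue_on {0..T}. f t = r * ?P t"
    using hf AE_space[of "lebesgue_on {0..T}"] by eventually_elim (use eq in auto)
  ultimately show ?thesis by blast
qed

section \<open>Moments of Brownian motion\<close>

lemma (in prob_space) normal_law_moments:
  assumes "has_normal_law M Y m s" "s \<ge> 0"
  shows "random_variable borel Y" "integrable M Y" "integrable M (\<lambda>x. (Y x)\<^sup>2)"
    "expectation Y = m" "expectation (\<lambda>x. (Y x - m)\<^sup>2) = s\<^sup>2"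
proof -
  have Y: "Y \<in> borel_measurable M" using assms by (simp add: has_normal_law_def)
  then show "random_variable borel Y" .
  have *: "integrable M (\<lambda>x. Y x - m) \<and> integrable M (\<lambda>x. (Y x - m)\<^sup>2)
      \<and> expectation (\<lambda>x. Y x - m) = 0 \<and> expectation (\<lambda>x. (Y x - m)\<^sup>2) = s\<^sup>2"
  proof (cases "s = 0")
    case True
    then have d: "distr M borel Y = return borel m" using assms by (simp add: has_normal_law_def)
    have "AE y in distr M borel Y. y = m" unfolding d by (subst AE_return) auto
    then have "AE x in M. Y x = m" by (subst (asm) AE_distr_iff[OF Y]) auto
    then have ae: "AE x in M. Y x - m = 0" "AE x in M. (Y x - m)\<^sup>2 = 0" by auto
    have [measurable]: "Y \<in> borel_measurable M" by (rule Y)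
    have "integrable M (\<lambda>x. Y x - m) \<longleftrightarrow> integrable M (\<lambda>x. 0 :: real)"
      using ae by (intro integrable_cong_AE) auto
    moreover have "integrable M (\<lambda>x. (Y x - m)\<^sup>2) \<longleftrightarrow> integrable M (\<lambda>x. 0 :: real)"
      using ae by (intro integrable_cong_AE) auto
    ultimately show ?thesis using True integral_eq_zero_AE[OF ae(1)] integral_eq_zero_AE[OF ae(2)] by simp
  next
    case False
    then have s: "0 < s" using assms by simp
    have "distr M borel Y = density lborel (normal_density m s)" 
      using assms False by (simp add: has_normal_law_def)
    then have D: "distributed M lborel Y (normal_density m s)"
      unfolding distributed_def using Y by (auto cong: distr_cong)
    show ?thesis
      using distributed_integrable[OF D, of "\<lambda>y. y - m"] distributed_integrable[OF D, of "\<lambda>y. (y - m)\<^sup>2"]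
        distributed_integral[OF D, of "\<lambda>y. y - m"] distributed_integral[OF D, of "\<lambda>y. (y - m)\<^sup>2"]
        integrable_normal_moment[OF s, of m 1] integrable_normal_moment[OF s, of m 2]
        integral_normal_moment_odd[OF s, of m 0] integral_normal_moment_even[OF s, of m 1]
      by simp
  qed
  then have i: "integrable M (\<lambda>x. Y x - m)" "integrable M (\<lambda>x. (Y x - m)\<^sup>2)" by auto
  from Bochner_Integration.integrable_add[OF i(1), of "\<lambda>_. m"] show Yi: "integrable M Y" by simp
  have "integrable M (\<lambda>x. (Y x - m)\<^sup>2 + 2 * m * (Y x - m) + m\<^sup>2)"
    using i by (intro Bochner_Integration.integrable_add) auto
  then show "integrable M (\<lambda>x. (Y x)\<^sup>2)"
    by (simp add: power2_eq_square algebra_simps)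
  show "expectation Y = m" using * Yi by (simp add: prob_space)
  show "expectation (\<lambda>x. (Y x - m)\<^sup>2) = s\<^sup>2" using * by simp
qed

lemma integrable_L2_mult:
  fixes f g :: "'a \<Rightarrow> real"
  assumes [measurable]: "f \<in> borel_measurable M" "g \<in> borel_measurable M"
    and "integrable M (\<lambda>x. (f x)\<^sup>2)" "integrable M (\<lambda>x. (g x)\<^sup>2)"
  shows "integrable M (\<lambda>x. f x * g x)"
proof (rule Bochner_Integration.integrable_bound)
  show "integrable M (\<lambda>x. (f x)\<^sup>2 + (g x)\<^sup>2)" using assms by auto
  show "AE x in M. norm (f x * g x) \<le> norm ((f x)\<^sup>2 + (g x)\<^sup>2)"
  proof (rule AE_I2)
    fix x
    have "2 * (\<bar>f x\<bar> * \<bar>g x\<bar>) \<le> (f x)\<^sup>2 + (g x)\<^sup>2"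
      using sum_squares_bound[of "\<bar>f x\<bar>" "\<bar>g x\<bar>"] by (simp add: algebra_simps)
    moreover have "0 \<le> \<bar>f x\<bar> * \<bar>g x\<bar>" by simp
    ultimately show "norm (f x * g x) \<le> norm ((f x)\<^sup>2 + (g x)\<^sup>2)"
      unfolding real_norm_def abs_mult by linarith
  qed
qed auto

lemma (in prob_space) brownian_moments:
  assumes W: "standard_brownian_motion M T W" and t: "t \<in> {0..T}"
  shows "W t \<in> borel_measurable M" "integrable M (W t)" "integrable M (\<lambda>x. (W t x)\<^sup>2)"
    "expectation (W t) = 0" "expectation (\<lambda>x. (W t x)\<^sup>2) = t"
proof -
  have W0: "W 0 \<in> borel_measurable M" "AE x in M. W 0 x = 0"
    and Wt[measurable]: "W t \<in> borel_measurable M"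
    using W t by (auto simp: standard_brownian_motion_def)
  have [measurable]: "W 0 \<in> borel_measurable M" by fact
  have law: "has_normal_law M (\<lambda>x. W t x - W 0 x) 0 (sqrt t)"
  proof (cases "t = 0")
    case True
    have "distr M borel (\<lambda>x. 0::real) = return borel 0"
      by (intro measure_eqI) (auto simp: emeasure_distr emeasure_space_1 split: split_indicator)
    then show ?thesis using True by (simp add: has_normal_law_def)
  next
    case False
    then have "0 \<le> (0::real) \<and> 0 < t \<and> t \<le> T" using t by auto
    moreover have "\<forall>s t. 0 \<le> s \<and> s < t \<and> t \<le> T \<longrightarrow>
        has_normal_law M (\<lambda>x. W t x - W s x) 0 (sqrt (t - s))"
      using W by (simp add: standard_brownian_motion_def)
    ultimately have "has_normal_law M (\<lambda>x. W t x - W 0 x) 0 (sqrt (t - 0))" by blast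
    then show ?thesis by simp
  qed
  have "0 \<le> sqrt t" using t by simp
  note mom = normal_law_moments[OF law this]
  have ae: "AE x in M. W t x = W t x - W 0 x" "AE x in M. (W t x)\<^sup>2 = (W t x - W 0 x)\<^sup>2"
    using W0(2) by auto
  show "W t \<in> borel_measurable M" by fact
  have "integrable M (W t) \<longleftrightarrow> integrable M (\<lambda>x. W t x - W 0 x)"
    by (rule integrable_cong_AE[OF _ _ ae(1)]) auto
  then show "integrable M (W t)" using mom by simp
  have "integrable M (\<lambda>x. (W t x)\<^sup>2) \<longleftrightarrow> integrable M (\<lambda>x. (W t x - W 0 x)\<^sup>2)"
    by (rule integrable_cong_AE[OF _ _ ae(2)]) auto
  then show "integrable M (\<lambda>x. (W t x)\<^sup>2)" using mom by simp
  have "expectation (W t) = expectation (\<lambda>x. W t x - W 0 x)"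
    by (rule integral_cong_AE[OF _ _ ae(1)]) auto
  then show "expectation (W t) = 0" using mom by simp
  have "expectation (\<lambda>x. (W t x)\<^sup>2) = expectation (\<lambda>x. (W t x - W 0 x)\<^sup>2)"
    by (rule integral_cong_AE[OF _ _ ae(2)]) auto
  then show "expectation (\<lambda>x. (W t x)\<^sup>2) = t" using mom t by simp
qed

text \<open>For \<open>s \<le> t\<close>, \<open>W\<^sub>s\<close> is uncorrelated with the increment \<open>W\<^sub>t - W\<^sub>s\<close>.\<close>

lemma (in prob_space) brownian_covariance:
  assumes W: "standard_brownian_motion M T W" and s: "s \<in> {0..T}" and t: "t \<in> {0..T}"
  shows "expectation (\<lambda>x. W s x * W t x) = min s t"
proof -
  have *: "expectation (\<lambda>x. W s x * W t x) = s" if st: "s \<le> t" and s: "s \<in> {0..T}" and t: "t \<in> {0..T}" for s t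
  proof -
    note ms = brownian_moments[OF W s] and mt = brownian_moments[OF W t]
    note [measurable] = ms(1) mt(1)
    have W0: "W 0 \<in> borel_measurable M" "AE x in M. W 0 x = 0"
      using W s by (auto simp: standard_brownian_motion_def)
    have [measurable]: "W 0 \<in> borel_measurable M" by fact
    \<comment> \<open>The partition \<open>0, s, t\<close>, continued constantly.\<close>
    define r :: "nat \<Rightarrow> real" where "r i = (if i = 0 then 0 else if i = 1 then s else t)" for i
    let ?D = "\<lambda>i x. W (r (Suc i)) x - W (r i) x"
    have "indep_vars (\<lambda>_. borel) ?D {..<2}"
    proof -
      have "0 \<le> r 0 \<and> (\<forall>i<2. r i \<le> r (Suc i)) \<and> r 2 \<le> T"
        using s t st by (auto simp: r_def less_Suc_eq numeral_2_eq_2)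
      then show ?thesis using W unfolding standard_brownian_motion_def by blast
    qed
    moreover have "integrable M (?D i)" if "i \<in> {..<2}" for i
    proof -
      have "r j \<in> {0..T}" for j using s t by (auto simp: r_def)
      then show ?thesis using brownian_moments(2)[OF W] by auto
    qed
    ultimately have "expectation (\<lambda>x. \<Prod>i\<in>{..<2}. ?D i x) = (\<Prod>i\<in>{..<2}. expectation (?D i))"
      by (intro indep_vars_lebesgue_integral) auto
    moreover have "{..<2::nat} = {0, 1}" by auto
    moreover have "expectation (\<lambda>x. W s x - W 0 x) = expectation (W s)"
      using W0(2) by (intro integral_cong_AE) auto
    ultimately have "expectation (\<lambda>x. (W s x - W 0 x) * (W t x - W s x)) = 0"
      using ms(4) by (simp add: r_def)
    moreover have "expectation (\<lambda>x. (W s x - W 0 x) * (W t x - W s x))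
       = expectation (\<lambda>x. W s x * W t x - (W s x)\<^sup>2)"
      using W0(2) by (intro integral_cong_AE) (auto simp: power2_eq_square algebra_simps)
    moreover have "integrable M (\<lambda>x. W s x * W t x)"
      by (rule integrable_L2_mult) (use ms mt in auto)
    ultimately show ?thesis using ms by simp
  qed
  show ?thesis
  proof (cases "s \<le> t")
    case True then show ?thesis using *[OF True s t] by simp
  next
    case False then show ?thesis using *[of t s] s t by (simp add: mult.commute)
  qed
qed

lemma (in prob_space) indep_set_subset:
  "indep_set A B \<Longrightarrow> C \<subseteq> B \<Longrightarrow> indep_set A C"
  unfolding indep_sets2_eq by blast

text \<open>The \<open>\<sigma>\<close>-algebra of \<open>W t\<close> is contained in that of the whole path, through the coordinate
  projection.\<close>

lemma (in prob_space) indep_of_process_expectation: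
  assumes indep: "indep_of_process M T Y W" and Y: "integrable M Y" and W: "integrable M (W t)"
    and t: "t \<in> {0..T}"
  shows "expectation (\<lambda>x. Y x * W t x) = expectation Y * expectation (W t)"
proof -
  have *: "{W t -` A \<inter> space M | A. A \<in> sets borel} \<subseteq> 
    {(\<lambda>x. \<lambda>t\<in>{0..T}. W t x) -` B \<inter> space M | B. B \<in> sets (PiM {0..T} (\<lambda>_. borel :: real measure))}"
  proof safe
    fix A :: "real set" assume A: "A \<in> sets borel"
    let ?B = "(\<lambda>f. f t) -` A \<inter> space (PiM {0..T} (\<lambda>_. borel :: real measure))"
    have "?B \<in> sets (PiM {0..T} (\<lambda>_. borel :: real measure))"
      using A t by (intro measurable_sets[OF measurable_component_singleton]) auto
    moreover have "W t -` A \<inter> space M = (\<lambda>x. \<lambda>t\<in>{0..T}. W t x) -` ?B \<inter> space M"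
      using t by (auto simp: space_PiM)
    ultimately show "\<exists>B. W t -` A \<inter> space M = (\<lambda>x. \<lambda>t\<in>{0..T}. W t x) -` B \<inter> space M \<and>
         B \<in> sets (PiM {0..T} (\<lambda>_. borel :: real measure))" by blast
  qed
  have sig: "sigma_sets (space M) {f -` A \<inter> space M | A. A \<in> sets borel} = {f -` A \<inter> space M | A. A \<in> sets borel}"
    if "f \<in> borel_measurable M" for f :: "'a \<Rightarrow> real"
    using sets_vimage_algebra2[of f "space M" borel]
    by (subst sets_vimage_algebra[symmetric], subst sets_vimage_algebra2) auto
  have "indep_var borel Y borel (W t)"
  proof -
    have "indep_set {Y -` A \<inter> space M | A. A \<in> sets borel} {W t -` A \<inter> space M | A. A \<in> sets borel}"
      using indep unfolding indep_of_process_def by (rule indep_set_subset[OF _ *])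
    then show ?thesis
      unfolding indep_var_eq using Y W sig[of Y] sig[of "W t"] by simp
  qed
  then show ?thesis using Y W by (rule indep_var_lebesgue_integral)
qed

section \<open>Time integrals of a process with continuous paths\<close>

text \<open>The process is the pointwise limit of its discretizations to the grids of mesh
  \<open>1 / Suc n\<close>, and a process read off at countably many times is jointly measurable.\<close>

lemma borel_measurable_continuous_process:
  fixes V :: "real \<Rightarrow> 'a \<Rightarrow> real"
  assumes cont: "\<And>x. continuous_on UNIV (\<lambda>t. V t x)" and V: "\<And>t. V t \<in> borel_measurable M"
  shows "(\<lambda>(t, x). V t x) \<in> borel_measurable (lborel \<Otimes>\<^sub>M M)"
proof -
  define g where "g n t = real_of_int \<lfloor>real (Suc n) * t\<rfloor> / real (Suc n)" for n t
  have g: "(\<lambda>n. g n t) \<longlonglongrightarrow> t" for t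
  proof (rule metric_LIMSEQ_I)
    fix e :: real assume "e > 0"
    then obtain N where N: "inverse (real (Suc N)) < e" using reals_Archimedean by blast
    have "dist (g n t) t < e" if "n \<ge> N" for n
    proof -
      have "real (Suc n) * \<bar>g n t - t\<bar> = \<bar>real (Suc n) * (g n t - t)\<bar>" by (simp add: abs_mult)
      also have "real (Suc n) * (g n t - t) = real_of_int \<lfloor>real (Suc n) * t\<rfloor> - real (Suc n) * t"
        unfolding g_def by (simp add: right_diff_distrib del: of_nat_Suc)
      also have "\<bar>\<dots>\<bar> \<le> 1"
        using of_int_floor_le[of "real (Suc n) * t"] real_of_int_floor_add_one_gt[of "real (Suc n) * t"]
        by linarith
      finally have "\<bar>g n t - t\<bar> \<le> inverse (real (Suc n))"
        by (simp add: field_simps del: of_nat_Suc)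
      also have "\<dots> \<le> inverse (real (Suc N))" using that by (intro le_imp_inverse_le) auto
      finally show ?thesis using N by (simp add: dist_real_def)
    qed
    then show "\<exists>no. \<forall>n\<ge>no. dist (g n t) t < e" by blast
  qed
  show ?thesis
  proof (rule borel_measurable_LIMSEQ_real)
    fix p :: "real \<times> 'a"
    obtain t x where p: "p = (t, x)" by (cases p)
    have "isCont (\<lambda>t. V t x) t" using cont[of x] by (simp add: continuous_on_eq_continuous_at)
    then have "(\<lambda>n. V (g n t) x) \<longlonglongrightarrow> V t x"
      using g[of t] by (rule isCont_tendsto_compose)
    then show "(\<lambda>n. case p of (t, x) \<Rightarrow> V (g n t) x) \<longlonglongrightarrow> (case p of (t, x) \<Rightarrow> V t x)"
      by (simp add: p)
  next
    fix n
    have "(\<lambda>p. V (real_of_int \<lfloor>real (Suc n) * fst p\<rfloor> / real (Suc n)) (snd p)) \<in> borel_measurable (lborel \<Otimes>\<^sub>M M)"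
    proof (rule measurable_compose_countable[where g = "\<lambda>p. \<lfloor>real (Suc n) * fst p\<rfloor>"])
      show "(\<lambda>p. V (real_of_int i / real (Suc n)) (snd p)) \<in> borel_measurable (lborel \<Otimes>\<^sub>M M)" for i
        by (rule measurable_compose[OF measurable_snd V])
      show "(\<lambda>p. \<lfloor>real (Suc n) * fst p\<rfloor>) \<in> lborel \<Otimes>\<^sub>M M \<rightarrow>\<^sub>M count_space UNIV"
        by measurable
    qed
    then show "(\<lambda>(t, x). V (g n t) x) \<in> borel_measurable (lborel \<Otimes>\<^sub>M M)"
      by (simp add: g_def case_prod_beta)
  qed
qed

lemma (in prob_space) expectation_time_integral:
  fixes K :: "real \<Rightarrow> 'a \<Rightarrow> real"
  assumes K[measurable]: "(\<lambda>(t, x). K t x) \<in> borel_measurable (lborel \<Otimes>\<^sub>M M)"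
    and int: "\<And>t. integrable M (K t)" and bd: "\<And>t. expectation (\<lambda>x. \<bar>K t x\<bar>) \<le> D"
    and a: "continuous_on UNIV a"
  shows "integrable M (\<lambda>x. LINT u:{0..t}|lborel. a u * K u x)"
    and "expectation (\<lambda>x. LINT u:{0..t}|lborel. a u * K u x) = integral {0..t} (\<lambda>u. a u * expectation (K u))"
proof -
  interpret P: pair_sigma_finite lborel M ..
  have [measurable]: "a \<in> borel_measurable borel" by (rule borel_measurable_continuous_onI[OF a])
  let ?F = "\<lambda>u x. indicator {0..t} u * (a u * K u x)"
  have meas: "(\<lambda>(u, x). ?F u x) \<in> borel_measurable (lborel \<Otimes>\<^sub>M M)" by measurable
  have "set_integrable lborel {0..t} (\<lambda>u. \<bar>a u\<bar> * D)"
    by (intro borel_integrable_atLeastAtMost' continuous_intros continuous_on_subset[OF a]) auto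
  then have dom: "integrable lborel (\<lambda>u. indicator {0..t} u * (\<bar>a u\<bar> * D))"
    by (simp add: set_integrable_def)
  have Fi: "integrable (lborel \<Otimes>\<^sub>M M) (\<lambda>(u, x). ?F u x)"
  proof (rule P.Fubini_integrable[OF meas])
    show "integrable lborel (\<lambda>u. LINT x|M. norm (case (u, x) of (u, x) \<Rightarrow> ?F u x))"
    proof (rule Bochner_Integration.integrable_bound[OF dom])
      show "(\<lambda>u. LINT x|M. norm (case (u, x) of (u, x) \<Rightarrow> ?F u x)) \<in> borel_measurable lborel"
        by measurable
      show "AE u in lborel. norm (LINT x|M. norm (case (u, x) of (u, x) \<Rightarrow> ?F u x))
          \<le> norm (indicator {0..t} u * (\<bar>a u\<bar> * D))"
      proof (rule AE_I2)
        fix u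
        have "(LINT x|M. norm (case (u, x) of (u, x) \<Rightarrow> ?F u x)) = indicator {0..t} u * (\<bar>a u\<bar> * expectation (\<lambda>x. \<bar>K u x\<bar>))"
          by (simp add: abs_mult)
        moreover have "\<bar>expectation (\<lambda>x. \<bar>K u x\<bar>)\<bar> \<le> \<bar>D\<bar>"
        proof -
          have "0 \<le> expectation (\<lambda>x. \<bar>K u x\<bar>)" by simp
          then show ?thesis using bd[of u] by linarith
        qed
        ultimately show "norm (LINT x|M. norm (case (u, x) of (u, x) \<Rightarrow> ?F u x))
          \<le> norm (indicator {0..t} u * (\<bar>a u\<bar> * D))"
          by (simp add: abs_mult mult_left_mono)
      qed
    qed
    show "AE u in lborel. integrable M (\<lambda>x. case (u, x) of (u, x) \<Rightarrow> ?F u x)"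
      using int by (intro AE_I2) simp
  qed
  have eq: "(LINT u:{0..t}|lborel. a u * K u x) = (LINT u|lborel. ?F u x)" for x
    by (simp add: set_lebesgue_integral_def)
  show "integrable M (\<lambda>x. LINT u:{0..t}|lborel. a u * K u x)"
    unfolding eq using P.integrable_snd[OF Fi] by simp
  have "expectation (\<lambda>x. LINT u:{0..t}|lborel. a u * K u x) = (LINT u|lborel. LINT x|M. ?F u x)"
    unfolding eq using P.Fubini_integral[OF Fi] by simp
  also have "\<dots> = (LINT u:{0..t}|lborel. a u * expectation (K u))"
    by (simp add: set_lebesgue_integral_def)
  also have "\<dots> = integral {0..t} (\<lambda>u. a u * expectation (K u))"
  proof (rule set_borel_integral_eq_integral)
    show "set_integrable lborel {0..t} (\<lambda>u. a u * expectation (K u))"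
      unfolding set_integrable_def using P.integrable_fst[OF Fi] by simp
  qed
  finally show "expectation (\<lambda>x. LINT u:{0..t}|lborel. a u * K u x) = integral {0..t} (\<lambda>u. a u * expectation (K u))" .
qed

text \<open>Expand the integral of the nonnegative function \<open>(t g - I)\<^sup>2\<close>, where \<open>I\<close> is the integral
  of \<open>g\<close>.\<close>

lemma integral_square_le:
  fixes g :: "real \<Rightarrow> real"
  assumes "continuous_on {0..t} g" "t \<ge> 0"
  shows "(integral {0..t} g)\<^sup>2 \<le> t * integral {0..t} (\<lambda>u. (g u)\<^sup>2)"
proof (cases "t = 0")
  case False
  let ?I = "integral {0..t} g"
  have i: "g integrable_on {0..t}" "(\<lambda>u. (g u)\<^sup>2) integrable_on {0..t}"
    using assms by (auto intro!: integrable_continuous_real continuous_intros)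
  have "((\<lambda>u. t\<^sup>2 * (g u)\<^sup>2 - 2 * t * ?I * g u + ?I\<^sup>2) has_integral
     (t\<^sup>2 * integral {0..t} (\<lambda>u. (g u)\<^sup>2) - 2 * t * ?I * ?I + ?I\<^sup>2 * (t - 0))) {0..t}"
    using i assms(2)
    by (intro has_integral_add has_integral_diff has_integral_mult_right integrable_integral)
       (use has_integral_const_real[of "?I\<^sup>2" 0 t] in \<open>auto simp: mult.commute\<close>)
  moreover have "(t * g u - ?I)\<^sup>2 = t\<^sup>2 * (g u)\<^sup>2 - 2 * t * ?I * g u + ?I\<^sup>2" for u
    by (simp add: power2_eq_square algebra_simps)
  ultimately have "((\<lambda>u. (t * g u - ?I)\<^sup>2) has_integral
     (t\<^sup>2 * integral {0..t} (\<lambda>u. (g u)\<^sup>2) - 2 * t * ?I * ?I + ?I\<^sup>2 * (t - 0))) {0..t}" by simp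
  then have "0 \<le> t\<^sup>2 * integral {0..t} (\<lambda>u. (g u)\<^sup>2) - 2 * t * ?I * ?I + ?I\<^sup>2 * (t - 0)"
    by (rule has_integral_nonneg) simp
  then have "0 \<le> t * (t * integral {0..t} (\<lambda>u. (g u)\<^sup>2) - ?I\<^sup>2)"
    by (simp add: power2_eq_square algebra_simps)
  then show ?thesis using False assms(2) by (simp add: zero_le_mult_iff)
qed simp

text \<open>Pairing with an arbitrary square integrable \<open>Z\<close> allows \<open>Z\<close> to be a time integral of the same
  process, which reduces double time integrals to this lemma applied twice.\<close>

lemma (in prob_space) mean_square_integral:
  fixes V :: "real \<Rightarrow> 'a \<Rightarrow> real"
  assumes cont: "\<And>x. continuous_on UNIV (\<lambda>t. V t x)"
    and V[measurable]: "\<And>t. V t \<in> borel_measurable M"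
    and V2: "\<And>t. integrable M (\<lambda>x. (V t x)\<^sup>2)" and bd: "\<And>t. expectation (\<lambda>x. (V t x)\<^sup>2) \<le> C"
    and a: "continuous_on UNIV a" and t: "t \<ge> 0"
  shows "(\<lambda>x. integral {0..t} (\<lambda>u. a u * V u x)) \<in> borel_measurable M"
    and "integrable M (\<lambda>x. (integral {0..t} (\<lambda>u. a u * V u x))\<^sup>2)"
    and "\<And>Z. Z \<in> borel_measurable M \<Longrightarrow> integrable M (\<lambda>x. (Z x)\<^sup>2) \<Longrightarrow>
      expectation (\<lambda>x. integral {0..t} (\<lambda>u. a u * V u x) * Z x)
        = integral {0..t} (\<lambda>u. a u * expectation (\<lambda>x. V u x * Z x))"
proof -
  have [measurable]: "(\<lambda>(t, x). V t x) \<in> borel_measurable (lborel \<Otimes>\<^sub>M M)"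
    by (rule borel_measurable_continuous_process[OF cont V])
  have [measurable]: "a \<in> borel_measurable borel" by (rule borel_measurable_continuous_onI[OF a])
  let ?I = "\<lambda>x. integral {0..t} (\<lambda>u. a u * V u x)"
  have caV: "continuous_on S (\<lambda>u. a u * V u x)" for S x
    by (intro continuous_on_mult continuous_on_subset[OF a] continuous_on_subset[OF cont]) auto
  have toL: "(LINT u:{0..t}|lborel. f u) = integral {0..t} f" if "continuous_on {0..t} f" for f :: "real \<Rightarrow> real"
    by (rule set_borel_integral_eq_integral[OF borel_integrable_atLeastAtMost'[OF that]])
  have "(\<lambda>x. LINT u:{0..t}|lborel. a u * V u x) \<in> borel_measurable M"
    unfolding set_lebesgue_integral_def by measurable
  then show Im[measurable]: "?I \<in> borel_measurable M" by (simp add: toL[OF caV])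
  have a2: "continuous_on UNIV (\<lambda>u. (a u)\<^sup>2)" by (intro continuous_intros a)
  have "integrable M (\<lambda>x. LINT u:{0..t}|lborel. (a u)\<^sup>2 * (V u x)\<^sup>2)"
    by (rule expectation_time_integral(1)[OF _ V2 _ a2, where D = C]) (use bd in auto)
  moreover have "(LINT u:{0..t}|lborel. (a u)\<^sup>2 * (V u x)\<^sup>2) = integral {0..t} (\<lambda>u. (a u * V u x)\<^sup>2)" for x
    unfolding power_mult_distrib[symmetric] by (rule toL) (intro continuous_on_power caV)
  ultimately have "integrable M (\<lambda>x. t * integral {0..t} (\<lambda>u. (a u * V u x)\<^sup>2))" by simp
  then show "integrable M (\<lambda>x. (?I x)\<^sup>2)"
    by (rule Bochner_Integration.integrable_bound)
      (use integral_square_le[OF caV t] in \<open>auto intro!: AE_I2 intro: order.trans[OF _ abs_ge_self]\<close>)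
  fix Z :: "'a \<Rightarrow> real" assume Z[measurable]: "Z \<in> borel_measurable M" and Z2: "integrable M (\<lambda>x. (Z x)\<^sup>2)"
  have VZ: "integrable M (\<lambda>x. V u x * Z x)" for u
    by (rule integrable_L2_mult[OF V Z V2 Z2])
  have VZb: "expectation (\<lambda>x. \<bar>V u x * Z x\<bar>) \<le> C + expectation (\<lambda>x. (Z x)\<^sup>2)" for u
  proof -
    have "expectation (\<lambda>x. \<bar>V u x * Z x\<bar>) \<le> expectation (\<lambda>x. (V u x)\<^sup>2 + (Z x)\<^sup>2)"
    proof (rule integral_mono)
      fix x
      have "2 * (\<bar>V u x\<bar> * \<bar>Z x\<bar>) \<le> (V u x)\<^sup>2 + (Z x)\<^sup>2"
        using sum_squares_bound[of "\<bar>V u x\<bar>" "\<bar>Z x\<bar>"] by (simp add: algebra_simps)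
      moreover have "0 \<le> \<bar>V u x\<bar> * \<bar>Z x\<bar>" by simp
      ultimately show "\<bar>V u x * Z x\<bar> \<le> (V u x)\<^sup>2 + (Z x)\<^sup>2" unfolding abs_mult by linarith
    qed (use VZ V2 Z2 in auto)
    also have "\<dots> \<le> C + expectation (\<lambda>x. (Z x)\<^sup>2)" using bd[of u] V2[of u] Z2 by simp
    finally show ?thesis .
  qed
  have "expectation (\<lambda>x. ?I x * Z x) = expectation (\<lambda>x. LINT u:{0..t}|lborel. a u * (V u x * Z x))"
  proof (rule Bochner_Integration.integral_cong[OF refl])
    fix x
    show "?I x * Z x = (LINT u:{0..t}|lborel. a u * (V u x * Z x))"
      unfolding mult.assoc[symmetric] by (simp add: toL[OF caV])
  qed
  also have "\<dots> = integral {0..t} (\<lambda>u. a u * expectation (\<lambda>x. V u x * Z x))"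
    by (rule expectation_time_integral(2)[OF _ VZ VZb a]) measurable
  finally show "expectation (\<lambda>x. ?I x * Z x) = integral {0..t} (\<lambda>u. a u * expectation (\<lambda>x. V u x * Z x))" .
qed

text \<open>Almost sure continuity does not give joint measurability of \<open>W\<close>. Setting the bad paths to
  \<open>0\<close> and freezing time outside \<open>[0,T]\<close> makes every path continuous on the whole line.\<close>

lemma (in prob_space) brownian_continuous_version:
  assumes W: "standard_brownian_motion M T W" and T: "T \<ge> 0"
  obtains V where "\<And>x. continuous_on UNIV (\<lambda>t. V t x)" "\<And>t. V t \<in> borel_measurable M"
    "AE x in M. \<forall>t\<in>{0..T}. V t x = W t x" "\<And>t. V t = V (max 0 (min T t))"
proof -
  have "AE x in M. continuous_on {0..T} (\<lambda>t. W t x)"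
    using W by (simp add: standard_brownian_motion_def)
  then obtain N where N: "{x \<in> space M. \<not> continuous_on {0..T} (\<lambda>t. W t x)} \<subseteq> N" "N \<in> null_sets M"
    by (auto elim!: AE_E intro: that simp: null_sets_def)
  define V where "V t x = (if x \<in> space M - N then W (max 0 (min T t)) x else 0)" for t x
  show ?thesis
  proof
    fix x
    show "continuous_on UNIV (\<lambda>t. V t x)"
    proof (cases "x \<in> space M - N")
      case True
      then have c: "continuous_on {0..T} (\<lambda>t. W t x)" using N by blast
      have "continuous_on UNIV (\<lambda>t. W (max 0 (min T t)) x)"
        by (rule continuous_on_compose2[OF c]) (use T in \<open>auto intro!: continuous_intros\<close>)
      then show ?thesis using True by (simp add: V_def)
    next
      case False
      then have "V t x = 0" for t by (auto simp: V_def)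
      then show ?thesis by simp
    qed
  next
    fix t
    have [measurable]: "W (max 0 (min T t)) \<in> borel_measurable M" "N \<in> sets M"
      using W T N by (auto simp: standard_brownian_motion_def)
    show "V t \<in> borel_measurable M" unfolding V_def by measurable
    show "V t = V (max 0 (min T t))" using T by (auto simp: V_def)
  next
    show "AE x in M. \<forall>t\<in>{0..T}. V t x = W t x"
      using AE_not_in[OF N(2)] AE_space by eventually_elim (auto simp: V_def)
  qed
qed

section \<open>The covariance of the Ornstein-Uhlenbeck process\<close>

text \<open>Variation of constants is applied to the drift integral \<open>G\<close>, which is differentiable, because
  the path itself need not be: \<open>G' + \<theta> G = \<theta> (\<mu> - x0 - \<sigma> v)\<close>.\<close>

lemma OU_path_formula:
  fixes x v :: "real \<Rightarrow> real"
  assumes cx: "continuous_on {0..T} x" and cv: "continuous_on {0..T} v"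
    and x: "\<And>t. t \<in> {0..T} \<Longrightarrow> x t = x0 + integral {0..t} (\<lambda>s. \<theta> * (\<mu> - x s)) + \<sigma> * v t"
    and t: "t \<in> {0..T}"
  shows "x t = exp (- \<theta> * t) * (x0 + \<mu> * (exp (\<theta> * t) - 1)
      + \<sigma> * (exp (\<theta> * t) * v t - integral {0..t} (\<lambda>u. \<theta> * exp (\<theta> * u) * v u)))"
proof -
  define G where "G t = integral {0..t} (\<lambda>s. \<theta> * (\<mu> - x s))" for t
  have dG: "(G has_real_derivative \<theta> * (\<mu> - x s)) (at s within {0..t})" if "s \<in> {0..t}" for s
    unfolding G_def using that t
    by (intro integral_has_real_derivative continuous_intros continuous_on_subset[OF cx]) auto
  let ?v = "\<lambda>u. \<theta> * exp (\<theta> * u) * v u"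
  have iv: "?v integrable_on {0..t}"
    using t by (intro integrable_continuous_real continuous_intros continuous_on_subset[OF cv]) auto
  let ?c = "\<lambda>u. (\<mu> - x0) * (\<theta> * exp (\<theta> * u))"
  have "integral {0..t} (\<lambda>u. ?c u - \<sigma> * ?v u) = exp (\<theta> * t) * G t - exp (\<theta> * 0) * G 0"
  proof (rule integral_real_derivative)
    fix s assume s: "s \<in> {0..t}"
    have "x s = x0 + G s + \<sigma> * v s" using x[of s] s t by (simp add: G_def)
    then have e: "\<theta> * exp (\<theta> * s) * G s + exp (\<theta> * s) * (\<theta> * (\<mu> - x s)) = ?c s - \<sigma> * ?v s"
      by (simp add: algebra_simps)
    have "((\<lambda>s. exp (\<theta> * s) * G s) has_real_derivative
        \<theta> * exp (\<theta> * s) * G s + exp (\<theta> * s) * (\<theta> * (\<mu> - x s))) (at s within {0..t})"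
      by (rule derivative_eq_intros dG[OF s] refl)+ simp
    then show "((\<lambda>s. exp (\<theta> * s) * G s) has_real_derivative ?c s - \<sigma> * ?v s) (at s within {0..t})"
      unfolding e .
  qed (use t in auto)
  moreover have "G 0 = 0" by (simp add: G_def)
  moreover have "integral {0..t} (\<lambda>u. ?c u - \<sigma> * ?v u) = integral {0..t} ?c - \<sigma> * integral {0..t} ?v"
    by (subst Henstock_Kurzweil_Integration.integral_diff)
       (use t in \<open>auto intro!: integrable_continuous_real continuous_intros continuous_on_subset[OF cv]\<close>)
  moreover have "integral {0..t} ?c = (\<mu> - x0) * exp (\<theta> * t) - (\<mu> - x0) * exp (\<theta> * 0)"
    using t by (intro integral_real_derivative) (auto intro!: derivative_eq_intros)
  ultimately have "exp (\<theta> * t) * G t = (\<mu> - x0) * (exp (\<theta> * t) - 1) - \<sigma> * integral {0..t} ?v"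
    by (simp add: algebra_simps)
  then have "exp (- \<theta> * t) * (exp (\<theta> * t) * G t)
     = exp (- \<theta> * t) * ((\<mu> - x0) * (exp (\<theta> * t) - 1) - \<sigma> * integral {0..t} ?v)" by simp
  then have "G t = exp (- \<theta> * t) * ((\<mu> - x0) * (exp (\<theta> * t) - 1) - \<sigma> * integral {0..t} ?v)"
    by (simp add: mult.assoc[symmetric] flip: exp_add)
  moreover have "x t = x0 + G t + \<sigma> * v t" using x[OF t] by (simp add: G_def)
  moreover have "exp (- \<theta> * t) * exp (\<theta> * t) = 1" by (simp flip: exp_add)
  ultimately show ?thesis by (simp only:) algebra
qed

text \<open>Integration by parts, with \<open>u \<mapsto> q (min s u)\<close> constant after \<open>s\<close>; the two pieces of the
  antiderivative are glued at the single exceptional point \<open>s\<close>.\<close>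

lemma integral_exp_min:
  fixes q q' P :: "real \<Rightarrow> real"
  assumes q: "\<And>u. (q has_real_derivative q' u) (at u)"
    and P: "\<And>u. (P has_real_derivative exp (\<theta> * u) * q' u) (at u)"
    and "s \<ge> 0" "t \<ge> 0" "q 0 = 0"
  shows "exp (\<theta> * t) * q (min s t) - integral {0..t} (\<lambda>u. \<theta> * exp (\<theta> * u) * q (min s u)) = P (min s t) - P 0"
proof -
  define F where "F u = exp (\<theta> * u) * q (min s u) - P (min s u)" for u
  have cq: "continuous_on UNIV q" "continuous_on UNIV P"
    using q P by (auto intro!: continuous_at_imp_continuous_on DERIV_isCont)
  have "((\<lambda>u. \<theta> * exp (\<theta> * u) * q (min s u)) has_integral F t - F 0) {0..t}"
  proof (rule fundamental_theorem_of_calculus_interior_strong[where S = "{s}"])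
    fix u assume u: "u \<in> {0<..<t} - {s}"
    show "(F has_vector_derivative \<theta> * exp (\<theta> * u) * q (min s u)) (at u)"
      unfolding has_real_derivative_iff_has_vector_derivative[symmetric]
    proof (cases "u < s")
      case True
      have "((\<lambda>u. exp (\<theta> * u) * q u - P u) has_real_derivative \<theta> * exp (\<theta> * u) * q (min s u)) (at u)"
        using True by (auto intro!: derivative_eq_intros q P)
      then show "(F has_real_derivative \<theta> * exp (\<theta> * u) * q (min s u)) (at u)"
        by (rule has_field_derivative_transform_within_open[where S = "{..<s}"])
           (use True in \<open>auto simp: F_def\<close>)
    next
      case False
      have "((\<lambda>u. exp (\<theta> * u) * q s - P s) has_real_derivative \<theta> * exp (\<theta> * u) * q (min s u)) (at u)"
        using False u by (auto intro!: derivative_eq_intros)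
      then show "(F has_real_derivative \<theta> * exp (\<theta> * u) * q (min s u)) (at u)"
        by (rule has_field_derivative_transform_within_open[where S = "{s<..}"])
           (use False u in \<open>auto simp: F_def\<close>)
    qed
  next
    show "continuous_on {0..t} F" unfolding F_def
      by (intro continuous_intros continuous_on_compose2[OF cq(1)] continuous_on_compose2[OF cq(2)]) auto
  qed (use assms in auto)
  then have "integral {0..t} (\<lambda>u. \<theta> * exp (\<theta> * u) * q (min s u)) = F t - F 0"
    by (rule integral_unique)
  then show ?thesis using assms by (simp add: F_def)
qed

text \<open>The proof computes \<open>E (V\<^sub>t Z\<^sub>s)\<close> first and then \<open>E (Z\<^sub>s Z\<^sub>t)\<close>, each time with \<open>integral_exp_min\<close>:
  the integrand \<open>min s u\<close> is replaced by \<open>(exp (\<theta> min s u) - 1) / \<theta>\<close> in the second step.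
  Independence of \<open>X\<^sub>0\<close> enters only through \<open>E (V\<^sub>u (X\<^sub>0 - m\<^sub>0)) = 0\<close>.\<close>

lemma (in prob_space) OU_covariance:
  assumes T: "T > 0" and \<theta>: "\<theta> > 0" and "\<sigma>0 \<ge> 0"
    and W: "standard_brownian_motion M T W" and X: "solves_OU M T \<theta> \<mu> \<sigma> W X"
    and X0: "has_normal_law M (X 0) m0 \<sigma>0" and indep: "indep_of_process M T (X 0) W"
    and s: "s \<in> {0..T}" and t: "t \<in> {0..T}"
  shows "cov_fun M X s t = OU_phi \<theta> \<sigma> \<sigma>0 (min s t) * exp (- \<theta> * max s t)"
proof -
  obtain V where cV: "\<And>x. continuous_on UNIV (\<lambda>t. V t x)" and V[measurable]: "\<And>t. V t \<in> borel_measurable M"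
    and VW: "AE x in M. \<forall>t\<in>{0..T}. V t x = W t x" and clamp: "\<And>t. V t = V (max 0 (min T t))"
    using brownian_continuous_version[OF W] T by auto
  have aeV: "AE x in M. V u x = W u x" if "u \<in> {0..T}" for u
    using VW by eventually_elim (use that in auto)
  note Wm = brownian_moments[OF W]
  have V2: "integrable M (\<lambda>x. (V u x)\<^sup>2)" "expectation (\<lambda>x. (V u x)\<^sup>2) = u" if u: "u \<in> {0..T}" for u
  proof -
    note [measurable] = Wm(1)[OF u]
    have ae: "AE x in M. (V u x)\<^sup>2 = (W u x)\<^sup>2" using aeV[OF u] by eventually_elim simp
    have "integrable M (\<lambda>x. (V u x)\<^sup>2) \<longleftrightarrow> integrable M (\<lambda>x. (W u x)\<^sup>2)"
      by (rule integrable_cong_AE[OF _ _ ae]) auto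
    then show "integrable M (\<lambda>x. (V u x)\<^sup>2)" using Wm(3)[OF u] by simp
    have "expectation (\<lambda>x. (V u x)\<^sup>2) = expectation (\<lambda>x. (W u x)\<^sup>2)"
      by (rule integral_cong_AE[OF _ _ ae]) auto
    then show "expectation (\<lambda>x. (V u x)\<^sup>2) = u" using Wm(5)[OF u] by simp
  qed
  have clampT: "max 0 (min T u) \<in> {0..T}" for u using T by auto
  have V2i: "integrable M (\<lambda>x. (V u x)\<^sup>2)" for u
    using V2(1)[OF clampT[of u]] by (simp flip: clamp)
  have V2b: "expectation (\<lambda>x. (V u x)\<^sup>2) \<le> T" for u
    using V2(2)[OF clampT[of u]] clampT[of u] by (simp flip: clamp)
  let ?a = "\<lambda>u. \<theta> * exp (\<theta> * u)"
  have ca: "continuous_on UNIV ?a" by (intro continuous_intros)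
  define I where "I t x = integral {0..t} (\<lambda>u. ?a u * V u x)" for t x
  define Z where "Z t x = exp (\<theta> * t) * V t x - I t x" for t x
  note ms = mean_square_integral[OF cV V V2i V2b ca]
  have I[measurable]: "I t \<in> borel_measurable M" and I2: "integrable M (\<lambda>x. (I t x)\<^sup>2)" if "t \<in> {0..T}" for t
    using ms(1,2)[of t] that by (auto simp: I_def[abs_def])
  have EI: "expectation (\<lambda>x. I t x * Y x) = integral {0..t} (\<lambda>u. ?a u * expectation (\<lambda>x. V u x * Y x))"
    if "t \<in> {0..T}" "Y \<in> borel_measurable M" "integrable M (\<lambda>x. (Y x)\<^sup>2)" for t Y
    using ms(3)[of t Y] that by (simp add: I_def)
  have Zm: "Z t \<in> borel_measurable M" if "t \<in> {0..T}" for t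
    unfolding Z_def using I[OF that] by measurable
  have Z2: "integrable M (\<lambda>x. (Z t x)\<^sup>2)" if t: "t \<in> {0..T}" for t
  proof -
    note [measurable] = I[OF t]
    have "integrable M (\<lambda>x. (exp (\<theta> * t))\<^sup>2 * (V t x)\<^sup>2 + (I t x)\<^sup>2 - 2 * (exp (\<theta> * t) * (V t x * I t x)))"
      using V2i I2[OF t] integrable_L2_mult[OF V I[OF t] V2i I2[OF t]] by auto
    then show ?thesis by (simp add: Z_def power2_diff power_mult_distrib mult.assoc)
  qed
  have EZ: "expectation (\<lambda>x. Z t x * Y x) = exp (\<theta> * t) * expectation (\<lambda>x. V t x * Y x)
      - integral {0..t} (\<lambda>u. ?a u * expectation (\<lambda>x. V u x * Y x))"
    if t: "t \<in> {0..T}" and Y: "Y \<in> borel_measurable M" "integrable M (\<lambda>x. (Y x)\<^sup>2)" for t Y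
  proof -
    note [measurable] = I[OF t] Y(1)
    have "expectation (\<lambda>x. Z t x * Y x) = expectation (\<lambda>x. exp (\<theta> * t) * (V t x * Y x) - I t x * Y x)"
      by (simp add: Z_def algebra_simps)
    also have "\<dots> = exp (\<theta> * t) * expectation (\<lambda>x. V t x * Y x) - expectation (\<lambda>x. I t x * Y x)"
      using integrable_L2_mult[OF V Y(1) V2i Y(2)] integrable_L2_mult[OF I[OF t] Y(1) I2[OF t] Y(2)] by simp
    finally show ?thesis using EI[OF t Y] by simp
  qed
  have EVV: "expectation (\<lambda>x. V s x * V t x) = min s t" if "s \<in> {0..T}" "t \<in> {0..T}" for s t
  proof -
    note [measurable] = Wm(1)[OF that(1)] Wm(1)[OF that(2)]
    have "expectation (\<lambda>x. V s x * V t x) = expectation (\<lambda>x. W s x * W t x)"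
      using aeV[OF that(1)] aeV[OF that(2)] by (intro integral_cong_AE) (auto elim: eventually_elim2)
    then show ?thesis using brownian_covariance[OF W that] by simp
  qed
  have EVZ: "expectation (\<lambda>x. V t x * Z s x) = (exp (\<theta> * min s t) - 1) / \<theta>"
    if s: "s \<in> {0..T}" and t: "t \<in> {0..T}" for s t
  proof -
    have "expectation (\<lambda>x. V t x * Z s x) = expectation (\<lambda>x. Z s x * V t x)" by (simp add: mult.commute)
    also have "\<dots> = exp (\<theta> * s) * min t s - integral {0..s} (\<lambda>u. ?a u * expectation (\<lambda>x. V u x * V t x))"
      using EZ[OF s V V2i] EVV[OF s t] by (simp add: min.commute)
    also have "integral {0..s} (\<lambda>u. ?a u * expectation (\<lambda>x. V u x * V t x)) = integral {0..s} (\<lambda>u. ?a u * min t u)"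
      using s t by (intro Henstock_Kurzweil_Integration.integral_cong) (auto simp: EVV min.commute)
    also have "exp (\<theta> * s) * min t s - \<dots> = exp (\<theta> * min t s) / \<theta> - exp (\<theta> * 0) / \<theta>"
      by (rule integral_exp_min[where q = "\<lambda>u. u" and q' = "\<lambda>_. 1" and P = "\<lambda>u. exp (\<theta> * u) / \<theta>"])
        (use \<theta> s t in \<open>auto intro!: derivative_eq_intros\<close>)
    finally show ?thesis by (simp add: min.commute diff_divide_distrib)
  qed
  have EZZ: "expectation (\<lambda>x. Z s x * Z t x) = (exp (2 * \<theta> * min s t) - 1) / (2 * \<theta>)"
  proof -
    let ?q = "\<lambda>u. (exp (\<theta> * u) - 1) / \<theta>"
    have "expectation (\<lambda>x. Z s x * Z t x) = expectation (\<lambda>x. Z t x * Z s x)" by (simp add: mult.commute)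
    also have "\<dots> = exp (\<theta> * t) * ?q (min s t) - integral {0..t} (\<lambda>u. ?a u * expectation (\<lambda>x. V u x * Z s x))"
      using EZ[OF t Zm[OF s] Z2[OF s]] EVZ[OF s t] by simp
    also have "integral {0..t} (\<lambda>u. ?a u * expectation (\<lambda>x. V u x * Z s x)) = integral {0..t} (\<lambda>u. ?a u * ?q (min s u))"
      using s t by (intro Henstock_Kurzweil_Integration.integral_cong) (auto simp: EVZ)
    also have "exp (\<theta> * t) * ?q (min s t) - \<dots> = exp (2 * \<theta> * min s t) / (2 * \<theta>) - exp (2 * \<theta> * 0) / (2 * \<theta>)"
      by (rule integral_exp_min[where q' = "\<lambda>u. exp (\<theta> * u)" and P = "\<lambda>u. exp (2 * \<theta> * u) / (2 * \<theta>)"])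
        (use \<theta> s t in \<open>auto intro!: derivative_eq_intros simp flip: exp_add\<close>)
    finally show ?thesis by (simp add: diff_divide_distrib)
  qed
  have EZ0: "expectation (\<lambda>x. Z r x * Y x) = 0"
    if r: "r \<in> {0..T}" and Y: "Y \<in> borel_measurable M" "integrable M (\<lambda>x. (Y x)\<^sup>2)"
      and 0: "\<And>u. u \<in> {0..T} \<Longrightarrow> expectation (\<lambda>x. V u x * Y x) = 0" for r Y
  proof -
    have "integral {0..r} (\<lambda>u. ?a u * expectation (\<lambda>x. V u x * Y x)) = integral {0..r} (\<lambda>u. 0)"
      using r by (intro Henstock_Kurzweil_Integration.integral_cong) (auto simp: 0)
    then show ?thesis using EZ[OF r Y] 0[OF r] by simp
  qed
  note X0m = normal_law_moments[OF X0 \<open>\<sigma>0 \<ge> 0\<close>]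
  note [measurable] = X0m(1)
  define Y where "Y x = X 0 x - m0" for x
  have Ym[measurable]: "Y \<in> borel_measurable M" unfolding Y_def by measurable
  have Y1: "integrable M Y" "expectation Y = 0" unfolding Y_def using X0m by (auto simp: prob_space)
  have Y2: "integrable M (\<lambda>x. (Y x)\<^sup>2)"
    using X0m unfolding Y_def by (auto simp: power2_diff)
  have EY2: "expectation (\<lambda>x. (Y x)\<^sup>2) = \<sigma>0\<^sup>2" using X0m by (simp add: Y_def)
  have EVY: "expectation (\<lambda>x. V u x * Y x) = 0" if u: "u \<in> {0..T}" for u
  proof -
    note [measurable] = Wm(1)[OF u]
    have "expectation (\<lambda>x. V u x * Y x) = expectation (\<lambda>x. X 0 x * W u x - m0 * W u x)"
      using aeV[OF u] by (intro integral_cong_AE) (auto simp: Y_def algebra_simps)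
    also have "\<dots> = expectation (\<lambda>x. X 0 x * W u x) - m0 * expectation (W u)"
      using integrable_L2_mult[OF X0m(1) Wm(1)[OF u] X0m(3) Wm(3)[OF u]] Wm(2)[OF u] by simp
    finally show ?thesis
      using indep_of_process_expectation[OF indep X0m(2) Wm(2)[OF u] u] Wm(4)[OF u] by simp
  qed
  have EV1: "expectation (\<lambda>x. V u x * 1) = 0" if u: "u \<in> {0..T}" for u
  proof -
    note [measurable] = Wm(1)[OF u]
    have "expectation (\<lambda>x. V u x * 1) = expectation (W u)"
      using aeV[OF u] by (intro integral_cong_AE) auto
    then show ?thesis using Wm(4)[OF u] by simp
  qed
  have EZ1: "expectation (Z r) = 0" if "r \<in> {0..T}" for r
    using EZ0[OF that _ _ EV1] by simp
  have EZY: "expectation (\<lambda>x. Z r x * Y x) = 0" if "r \<in> {0..T}" for r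
    using EZ0[OF that Ym Y2 EVY] .
  have Z1: "integrable M (Z r)" if "r \<in> {0..T}" for r
    using integrable_L2_mult[OF Zm[OF that] _ Z2[OF that], of "\<lambda>_. 1"] by simp
  have Xm: "X r \<in> borel_measurable M" if "r \<in> {0..T}" for r
    using X that by (simp add: solves_OU_def)
  have Xeq: "AE x in M. X r x = exp (- \<theta> * r) * (Y x + \<sigma> * Z r x) + (exp (- \<theta> * r) * (m0 + \<mu> * (exp (\<theta> * r) - 1)))"
    if r: "r \<in> {0..T}" for r
  proof -
    have 1: "AE x in M. continuous_on {0..T} (\<lambda>t. X t x)"
      and 2: "AE x in M. \<forall>t\<in>{0..T}. X t x = X 0 x + integral {0..t} (\<lambda>s. \<theta> * (\<mu> - X s x)) + \<sigma> * W t x"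
      using X by (auto simp: solves_OU_def)
    show ?thesis using 1 2 VW
    proof eventually_elim
      case (elim x)
      have path: "X u x = X 0 x + integral {0..u} (\<lambda>s. \<theta> * (\<mu> - X s x)) + \<sigma> * V u x"
        if u: "u \<in> {0..T}" for u
        unfolding bspec[OF elim(3) u] by (rule bspec[OF elim(2) u])
      have "X r x = exp (- \<theta> * r) * (X 0 x + \<mu> * (exp (\<theta> * r) - 1)
        + \<sigma> * (exp (\<theta> * r) * V r x - integral {0..r} (\<lambda>u. \<theta> * exp (\<theta> * u) * V u x)))"
        by (rule OU_path_formula[OF elim(1) continuous_on_subset[OF cV subset_UNIV] path r])
      then show ?case by (simp add: Z_def I_def Y_def algebra_simps)
    qed
  qed
  have EX: "expectation (X r) = exp (- \<theta> * r) * (m0 + \<mu> * (exp (\<theta> * r) - 1))" if r: "r \<in> {0..T}" for r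
  proof -
    note [measurable] = Zm[OF r] Xm[OF r]
    have "expectation (X r) = expectation (\<lambda>x. exp (- \<theta> * r) * (Y x + \<sigma> * Z r x) + (exp (- \<theta> * r) * (m0 + \<mu> * (exp (\<theta> * r) - 1))))"
      by (rule integral_cong_AE[OF _ _ Xeq[OF r]]) auto
    also have "\<dots> = exp (- \<theta> * r) * (expectation Y + \<sigma> * expectation (Z r)) + (exp (- \<theta> * r) * (m0 + \<mu> * (exp (\<theta> * r) - 1)))"
      using Y1(1) Z1[OF r] by (simp add: prob_space)
    finally show ?thesis using Y1(2) EZ1[OF r] by simp
  qed
  note [measurable] = Zm[OF s] Zm[OF t] Xm[OF s] Xm[OF t]
  have "cov_fun M X s t = expectation (\<lambda>x. exp (- \<theta> * s) * exp (- \<theta> * t) *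
      ((Y x)\<^sup>2 + \<sigma> * (Z s x * Y x) + \<sigma> * (Z t x * Y x) + \<sigma>\<^sup>2 * (Z s x * Z t x)))"
    unfolding cov_fun_def EX[OF s] EX[OF t]
  proof (rule integral_cong_AE)
    show "AE x in M. (X s x - exp (- \<theta> * s) * (m0 + \<mu> * (exp (\<theta> * s) - 1))) *
         (X t x - exp (- \<theta> * t) * (m0 + \<mu> * (exp (\<theta> * t) - 1))) =
         exp (- \<theta> * s) * exp (- \<theta> * t) *
         ((Y x)\<^sup>2 + \<sigma> * (Z s x * Y x) + \<sigma> * (Z t x * Y x) + \<sigma>\<^sup>2 * (Z s x * Z t x))"
      using Xeq[OF s] Xeq[OF t]
    proof eventually_elim
      case (elim x)
      show ?case unfolding elim add_diff_cancel_right' by (simp add: power2_eq_square algebra_simps)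
    qed
  qed measurable
  also have "\<dots> = exp (- \<theta> * s) * exp (- \<theta> * t) * (expectation (\<lambda>x. (Y x)\<^sup>2)
      + \<sigma> * expectation (\<lambda>x. Z s x * Y x) + \<sigma> * expectation (\<lambda>x. Z t x * Y x)
      + \<sigma>\<^sup>2 * expectation (\<lambda>x. Z s x * Z t x))"
    using Y2 integrable_L2_mult[OF Zm[OF s] Ym Z2[OF s] Y2] integrable_L2_mult[OF Zm[OF t] Ym Z2[OF t] Y2]
      integrable_L2_mult[OF Zm[OF s] Zm[OF t] Z2[OF s] Z2[OF t]] by simp
  also have "\<dots> = exp (- \<theta> * s) * exp (- \<theta> * t) * (\<sigma>0\<^sup>2 + \<sigma>\<^sup>2 * ((exp (2 * \<theta> * min s t) - 1) / (2 * \<theta>)))"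
    by (simp only: EY2 EZY[OF s] EZY[OF t] EZZ) simp
  also have "exp (- \<theta> * s) * exp (- \<theta> * t) = exp (- \<theta> * min s t) * exp (- \<theta> * max s t)"
    by (simp add: min_def max_def)
  also have "exp (- \<theta> * min s t) * exp (- \<theta> * max s t) *
       (\<sigma>0\<^sup>2 + \<sigma>\<^sup>2 * ((exp (2 * \<theta> * min s t) - 1) / (2 * \<theta>))) = OU_phi \<theta> \<sigma> \<sigma>0 (min s t) * exp (- \<theta> * max s t)"
  proof -
    have e: "exp (2 * \<theta> * min s t) = exp (\<theta> * min s t) * exp (\<theta> * min s t)"
      by (simp flip: exp_add)
    show ?thesis unfolding e OU_phi_def using \<theta>
      by (simp add: sinh_def field_simps exp_minus)
  qed
  finally show ?thesis .
qed

section \<open>The eigensystem\<close>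

lemma OU_nondegenerate_if_countable_frequencies:
  assumes "countable (OU_frequencies T \<theta> \<sigma> \<sigma>0)"
  shows "(\<sigma>, \<sigma>0) \<noteq> (0, 0)"
proof
  assume "(\<sigma>, \<sigma>0) = (0, 0)"
  then have "{0<..<1} \<subseteq> OU_frequencies T \<theta> \<sigma> \<sigma>0" by (auto simp: OU_frequencies_def)
  then have "countable {0<..<1::real}" using assms countable_subset by blast
  then show False using uncountable_open_interval[of "0::real" 1] by simp
qed

lemma L2_inner_OU_eigenfunction:
  "L2_inner T (OU_eigenfunction T \<theta> \<sigma> \<sigma>0 \<omega>) (OU_eigenfunction T \<theta> \<sigma> \<sigma>0 \<omega>') =
     OU_normalization T \<theta> \<sigma> \<sigma>0 \<omega> * OU_normalization T \<theta> \<sigma> \<sigma>0 \<omega>' *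
     L2_inner T (OU_profile \<theta> \<sigma> \<sigma>0 \<omega>) (OU_profile \<theta> \<sigma> \<sigma>0 \<omega>')"
proof -
  have "L2_inner T (OU_eigenfunction T \<theta> \<sigma> \<sigma>0 \<omega>) (OU_eigenfunction T \<theta> \<sigma> \<sigma>0 \<omega>') =
     (LINT t|lebesgue_on {0..T}. OU_normalization T \<theta> \<sigma> \<sigma>0 \<omega> * OU_normalization T \<theta> \<sigma> \<sigma>0 \<omega>' *
        (OU_profile \<theta> \<sigma> \<sigma>0 \<omega> t * OU_profile \<theta> \<sigma> \<sigma>0 \<omega>' t))"
    unfolding L2_inner_def OU_eigenfunction_def
    by (intro Bochner_Integration.integral_cong refl) (simp add: ac_simps)
  then show ?thesis by (simp only: integral_mult_right_zero L2_inner_def)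
qed

theorem propositionA3:
  fixes M :: "'a measure"
    and T \<theta> \<sigma> \<sigma>0 \<mu> m0 :: real
    and W X :: "real \<Rightarrow> 'a \<Rightarrow> real"
    and w :: "nat \<Rightarrow> real"
  assumes "prob_space M"
    and "T > 0" and "\<theta> > 0" and "\<sigma> \<ge> 0" and "\<sigma>0 \<ge> 0"
    and "standard_brownian_motion M T W"
    and "solves_OU M T \<theta> \<mu> \<sigma> W X"
    and "has_normal_law M (X 0) m0 \<sigma>0"
    and "indep_of_process M T (X 0) W"
    and "strict_mono_on {1..} w"
    and "w ` {1..} = OU_frequencies T \<theta> \<sigma> \<sigma>0"
  shows "orthonormal_eigenvectors T (cov_fun M X)
           (\<lambda>n. OU_eigenfunction T \<theta> \<sigma> \<sigma>0 (w n)) (\<lambda>n. OU_eigenvalue \<theta> \<sigma> (w n))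
       \<and> (OU_no_extra_eigenvalue T \<theta> \<sigma> \<sigma>0 \<longrightarrow>
           KL_eigensystem T (cov_fun M X)
             (\<lambda>n. OU_eigenfunction T \<theta> \<sigma> \<sigma>0 (w n)) (\<lambda>n. OU_eigenvalue \<theta> \<sigma> (w n)))
       \<and> ((\<sigma>, \<sigma>0) \<noteq> (0, 0) \<longrightarrow>
           (\<forall>n\<ge>1. 1 / (OU_normalization T \<theta> \<sigma> \<sigma>0 (w n))\<^sup>2 =
               1 / 2 * \<sigma>0\<^sup>2 * (\<sigma>\<^sup>2 - \<theta> * \<sigma>0\<^sup>2) * (1 - cos (2 * w n * T))
             + 1 / 2 * \<sigma>0 ^ 4 * (w n)\<^sup>2 * (T + sin (2 * w n * T) / (2 * w n))
             + 1 / 2 * (\<sigma>\<^sup>2 - \<theta> * \<sigma>0\<^sup>2)\<^sup>2 * (T - sin (2 * w n * T) / (2 * w n))))"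
proof -
  interpret prob_space M by fact
  define e where "e n = OU_eigenfunction T \<theta> \<sigma> \<sigma>0 (w n)" for n
  define l where "l n = OU_eigenvalue \<theta> \<sigma> (w n)" for n
  let ?K = "\<lambda>n. OU_normalization T \<theta> \<sigma> \<sigma>0 (w n)"
  let ?P = "\<lambda>n. OU_profile \<theta> \<sigma> \<sigma>0 (w n)"
  have fr: "w n \<in> OU_frequencies T \<theta> \<sigma> \<sigma>0" if "n \<ge> 1" for n
    using assms(11) that by blast
  have wpos: "w n > 0" if "n \<ge> 1" for n using fr[OF that] by (simp add: OU_frequency_iff)
  have wless: "w m < w n" if "1 \<le> m" "m < n" for m n
    using assms(10) that by (auto simp: strict_mono_on_def)
  have nz: "(\<sigma>, \<sigma>0) \<noteq> (0, 0)"
    by (rule OU_nondegenerate_if_countable_frequencies[of T \<theta>]) (simp flip: assms(11))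
  have k: "cov_fun M X s t = OU_phi \<theta> \<sigma> \<sigma>0 (min s t) * exp (- \<theta> * max s t)"
    if "s \<in> {0..T}" "t \<in> {0..T}" for s t
    by (rule OU_covariance[OF assms(2,3,5,6,7,8,9) that])
  have pos: "L2_inner T (?P n) (?P n) > 0" if "n \<ge> 1" for n
    by (rule OU_profile_L2_norm_pos[OF assms(2) wpos[OF that] nz])
  have K2: "1 / (?K n)\<^sup>2 = L2_inner T (?P n) (?P n)" if "n \<ge> 1" for n
    using pos[OF that] by (simp add: OU_normalization_def L2_norm_def power_divide)
  have K0: "?K n > 0" if "n \<ge> 1" for n
    using pos[OF that] by (simp add: OU_normalization_def L2_norm_def)
  have inner: "L2_inner T (e m) (e n) = (if m = n then 1 else 0)" if "m \<ge> 1" "n \<ge> 1" for m n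
  proof (cases "m = n")
    case True
    have "(?K n)\<^sup>2 * L2_inner T (?P n) (?P n) = 1"
      using K0[OF that(2)] by (simp flip: K2[OF that(2)])
    then show ?thesis using True by (simp add: e_def L2_inner_OU_eigenfunction power2_eq_square)
  next
    case False
    then have "w m \<noteq> w n" using wless[of m n] wless[of n m] that by (cases "m < n") auto
    then have "L2_inner T (?P m) (?P n) = 0"
      by (rule OU_profile_orthogonal[OF assms(2) fr[OF that(1)] fr[OF that(2)]])
    then show ?thesis using False by (simp add: e_def L2_inner_OU_eigenfunction)
  qed
  have ev: "is_eigenvector T (cov_fun M X) (l n) (e n)" if n: "n \<ge> 1" for n
    unfolding is_eigenvector_def
  proof (intro conjI)
    have ce: "continuous_on {0..T} (e n)"
      unfolding e_def OU_eigenfunction_def[abs_def] by (intro continuous_intros OU_profile_continuous)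
    show "e n \<in> L2_on T" unfolding L2_on_def
      using ce by (auto intro!: continuous_imp_measurable_on_sets_lebesgue continuous_imp_integrable_real continuous_intros)
    show "\<not> (AE t in lebesgue_on {0..T}. e n t = 0)"
    proof
      assume "AE t in lebesgue_on {0..T}. e n t = 0"
      then have "AE t in lebesgue_on {0..T}. e n t * e n t = 0" by eventually_elim simp
      then have "L2_inner T (e n) (e n) = 0" unfolding L2_inner_def by (rule integral_eq_zero_AE)
      then show False using inner[OF n n] by simp
    qed
    show "AE t in lebesgue_on {0..T}. kernel_operator T (cov_fun M X) (e n) t = l n * e n t"
    proof (rule AE_I2)
      fix t assume "t \<in> space (lebesgue_on {0..T})"
      then have t: "t \<in> {0..T}" by simp
      have "kernel_operator T (cov_fun M X) (e n) t
          = (LINT s|lebesgue_on {0..T}. ?K n * (cov_fun M X s t * ?P n s))"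
        unfolding kernel_operator_def e_def OU_eigenfunction_def
        by (intro Bochner_Integration.integral_cong refl) (simp add: ac_simps)
      also have "\<dots> = ?K n * kernel_operator T (cov_fun M X) (?P n) t"
        by (simp only: integral_mult_right_zero kernel_operator_def)
      also have "kernel_operator T (cov_fun M X) (?P n) t = l n * ?P n t"
        unfolding l_def by (rule kernel_operator_OU_profile[OF assms(3) t fr[OF n]]) (rule k[OF _ t])
      finally show "kernel_operator T (cov_fun M X) (e n) t = l n * e n t"
        by (simp add: e_def OU_eigenfunction_def[abs_def])
    qed
  qed
  have on: "orthonormal_eigenvectors T (cov_fun M X) e l"
    unfolding orthonormal_eigenvectors_def using ev inner by simp
  have KL: "KL_eigensystem T (cov_fun M X) e l" if ne: "OU_no_extra_eigenvalue T \<theta> \<sigma> \<sigma>0"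
    unfolding KL_eigensystem_def
  proof (intro conjI allI impI on)
    have "\<sigma> \<noteq> 0"
    proof
      assume "\<sigma> = 0"
      moreover have "0 \<le> \<theta>\<^sup>2 * T * \<sigma>0\<^sup>2" using assms(2) by simp
      ultimately show False using ne by (simp add: OU_no_extra_eigenvalue_def)
    qed
    fix n :: nat assume n: "1 \<le> n"
    have d: "(w n)\<^sup>2 + \<theta>\<^sup>2 > 0" using wpos[OF n] by (simp add: add_pos_nonneg)
    show "0 < l n" using d \<open>\<sigma> \<noteq> 0\<close> by (simp add: l_def OU_eigenvalue_def)
    have "(w n)\<^sup>2 \<le> (w (Suc n))\<^sup>2"
      using wless[of n "Suc n"] wpos[OF n] n by (intro power_mono) auto
    then show "l (Suc n) \<le> l n" unfolding l_def OU_eigenvalue_def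
      using d by (intro divide_left_mono mult_pos_pos) auto
  next
    fix c f assume cf: "c \<noteq> 0 \<and> is_eigenvector T (cov_fun M X) c f"
    have "\<exists>\<omega>\<in>OU_frequencies T \<theta> \<sigma> \<sigma>0. c = OU_eigenvalue \<theta> \<sigma> \<omega> \<and>
           (\<exists>b. AE t in lebesgue_on {0..T}. f t = b * OU_profile \<theta> \<sigma> \<sigma>0 \<omega> t)"
      by (rule OU_eigenvector_is_profile[OF assms(2,3) ne conjunct1[OF cf] conjunct2[OF cf]]) (rule k)
    then obtain \<omega> b where om: "\<omega> \<in> OU_frequencies T \<theta> \<sigma> \<sigma>0" "c = OU_eigenvalue \<theta> \<sigma> \<omega>"
      and f: "AE t in lebesgue_on {0..T}. f t = b * OU_profile \<theta> \<sigma> \<sigma>0 \<omega> t"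
      by blast
    from om(1) obtain n where n: "n \<ge> 1" "\<omega> = w n" unfolding assms(11)[symmetric] by auto
    show "\<exists>A a. finite A \<and> A \<subseteq> {n. 1 \<le> n \<and> l n = c} \<and>
           (AE t in lebesgue_on {0..T}. f t = (\<Sum>n\<in>A. a n * e n t))"
    proof (intro exI conjI)
      show "{n} \<subseteq> {n. 1 \<le> n \<and> l n = c}" using n om by (simp add: l_def)
      show "AE t in lebesgue_on {0..T}. f t = (\<Sum>n\<in>{n}. b / ?K n * e n t)"
        using f by eventually_elim (use K0[OF n(1)] n in \<open>simp add: e_def OU_eigenfunction_def\<close>)
    qed simp
  qed
  have "1 / (?K n)\<^sup>2 = 1 / 2 * \<sigma>0\<^sup>2 * (\<sigma>\<^sup>2 - \<theta> * \<sigma>0\<^sup>2) * (1 - cos (2 * w n * T))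
             + 1 / 2 * \<sigma>0 ^ 4 * (w n)\<^sup>2 * (T + sin (2 * w n * T) / (2 * w n))
             + 1 / 2 * (\<sigma>\<^sup>2 - \<theta> * \<sigma>0\<^sup>2)\<^sup>2 * (T - sin (2 * w n * T) / (2 * w n))" if "n \<ge> 1" for n
    unfolding K2[OF that] by (rule OU_profile_L2_norm[OF assms(2) wpos[OF that]])
  then show ?thesis using on KL unfolding e_def l_def by simp
qed

end
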